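(* Let $F$ be a finite pin-jointed bar framework in the Euclidean plane, with pairwise distinct joint positions, that is isostatic in the plane, and let $\mathcal{G}$ be its point group of symmetries. Then every element of $\mathcal{G}$ is the identity, a half-turn $C_2$, a three-fold rotation (by $\pm 2\pi/3$), or a reflection in a line, and $\mathcal{G}$ is one of the six groups $\mathcal{C}_1,\mathcal{C}_2,\mathcal{C}_3,\mathcal{C}_s,\mathcal{C}_{2v},\mathcal{C}_{3v}$. Moreover $b=2j-3$ in every case, and the following hold. (1) If $\mathcal{G}=\mathcal{C}_2$, then $b_2=1$ and $j_c=0$; all other bars and all joints occur in pairs, so $j$ is even and $b$ is odd. (2) If $\mathcal{G}=\mathcal{C}_3$, then $j_c=0$, and all joints and all bars occur in sets of $3$. (3) If $\mathcal{G}=\mathcal{C}_s$, then $b_\sigma=1$, and all other bars occur in pairs. (4) If $\mathcal{G}=\mathcal{C}_{2v}$, then $j_c=0$, $b_2=1$, and $b_\sigma=1$ for each of the two mirror lines. The unique bar unshifted by the half-turn lies in one of the two mirror lines and is perpendicular to the other; all additional bars occur in sets of $4$, and joints occur in sets of $2$ and $4$, so $b$ is odd and $j$ is even. (5) If $\mathcal{G}=\mathcal{C}_{3v}$, then $j_c=0$ and $b_\sigma=1$ for each of the three mirror lines.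
   Context: A framework in the plane consists of a finite simple graph with joint set $J$ ($|J|=j$) and bar set $B$ ($|B|=b$), together with an injective map $p$ from $J$ to $\mathbb{R}^2$. Its compatibility matrix $\mathbf{C}$ is the $b\times 2j$ matrix sending infinitesimal joint displacements to infinitesimal bar extensions; up to multiplying each row by the length of the corresponding bar it is the rigidity matrix, whose row for a bar $\{u,v\}$ has $p(u)-p(v)$ in the columns of $u$, $p(v)-p(u)$ in the columns of $v$, and $0$ elsewhere. Let $r=\operatorname{rank}\mathbf{C}$. The number of states of self-stress is $s=b-r$, and the number of infinitesimal internal mechanisms $m$ is defined by $m+3=2j-r$ (the $3$ counts rigid-body motions in the plane). The framework is isostatic if $m=s=0$. The point group $\mathcal{G}$ of the framework is the group of isometries of the plane that permute the joint positions and map bars to bars. The possible planar point groups are $\mathcal{C}_n$ (generated by a rotation $C_n$ by $2\pi/n$ about a point) and $\mathcal{C}_{nv}$ (generated by $C_n$ and a reflection $\sigma$ in a line through that point), $n\ge 1$; $\mathcal{C}_1$ is trivial and $\mathcal{C}_{1v}$ is denoted $\mathcal{C}_s$. A joint is unshifted by a symmetry operation if it is mapped to itself; a bar is unshifted if it is mapped to itself (possibly with its two ends interchanged). Notation: $j_c$ is the number of joints (0 or 1) located at the centre of rotation; $b_2$ is the number of bars unshifted by the half-turn $C_2$ (i.e. bars whose midpoint is the centre of rotation); for a given mirror line, $b_\sigma$ is the number of bars unshifted by the reflection in it (bars lying in the mirror line, or perpendicular to it and with midpoint on it). "Occur in pairs", "in sets of $k$" means that the elements in question are partitioned into $\mathcal{G}$-orbits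 of size $2$, respectively $k$. *)

theory Defs
  imports "HOL-Analysis.Analysis" "HOL-Library.Disjoint_Sets"
    "HOL-Algebra.Bij" "HOL-Algebra.Generated_Groups"
begin

type_synonym plane = "real ^ 2"

text \<open>
  Joints and bars are indexed by finite types \<open>'j\<close> and \<open>'b\<close>, so that the compatibility matrix is a
  genuine matrix with \<open>CARD('b)\<close> rows and \<open>2 * CARD('j)\<close> columns; a graph is given by the set of ends of
  each bar.  Types are nonempty, but this excludes nothing relevant: a framework without
  bars has \<open>r = 0\<close> and hence \<open>m = 2 * j - 3 \<noteq> 0\<close>, and one without joints has no bars.
\<close>

definition framework :: "('b::finite \<Rightarrow> 'j::finite set) \<Rightarrow> ('j \<Rightarrow> plane) \<Rightarrow> bool" where
  "framework ends p \<longleftrightarrow> (\<forall>e. card (ends e) = 2) \<and> inj ends \<and> inj p"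

definition other_end :: "('b \<Rightarrow> 'j set) \<Rightarrow> 'b \<Rightarrow> 'j \<Rightarrow> 'j" where
  "other_end ends e u = the_elem (ends e - {u})"

text \<open>
  The row of a bar is its rigidity-matrix row divided by the length of the bar, so that it yields the
  actual first-order extension.
\<close>

definition compat_matrix ::
  "('b::finite \<Rightarrow> 'j::finite set) \<Rightarrow> ('j \<Rightarrow> plane) \<Rightarrow> real ^ ('j \<times> 2) ^ 'b" where
  "compat_matrix ends p =
     (\<chi> e c. case c of (u, i) \<Rightarrow>
        if u \<in> ends e
        then (p u - p (other_end ends e u)) $ i / dist (p u) (p (other_end ends e u))
        else 0)"

definition self_stress_count :: "('b::finite \<Rightarrow> 'j::finite set) \<Rightarrow> ('j \<Rightarrow> plane) \<Rightarrow> int" where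
  "self_stress_count ends p = int CARD('b) - int (rank (compat_matrix ends p))"

definition mechanism_count :: "('b::finite \<Rightarrow> 'j::finite set) \<Rightarrow> ('j \<Rightarrow> plane) \<Rightarrow> int" where
  "mechanism_count ends p = 2 * int CARD('j) - int (rank (compat_matrix ends p)) - 3"

definition isostatic :: "('b::finite \<Rightarrow> 'j::finite set) \<Rightarrow> ('j \<Rightarrow> plane) \<Rightarrow> bool" where
  "isostatic ends p \<longleftrightarrow> mechanism_count ends p = 0 \<and> self_stress_count ends p = 0"

definition plane_isometry :: "(plane \<Rightarrow> plane) \<Rightarrow> bool" where
  "plane_isometry g \<longleftrightarrow> bij g \<and> (\<forall>x y. dist (g x) (g y) = dist x y)"

definition point_group ::
  "('b::finite \<Rightarrow> 'j::finite set) \<Rightarrow> ('j \<Rightarrow> plane) \<Rightarrow> (plane \<Rightarrow> plane) set" where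
  "point_group ends p =
     {g. plane_isometry g \<and> bij_betw g (range p) (range p) \<and>
         (\<forall>e. \<exists>e'. g ` p ` ends e = p ` ends e')}"

definition rotation :: "plane \<Rightarrow> real \<Rightarrow> plane \<Rightarrow> plane" where
  "rotation c t x = c + vector [vector [cos t, - sin t], vector [sin t, cos t]] *v (x - c)"

definition is_line :: "plane set \<Rightarrow> bool" where
  "is_line L \<longleftrightarrow> affine L \<and> aff_dim L = 1"

text \<open>The closest point of a line is the foot of the perpendicular.\<close>

definition reflection :: "plane set \<Rightarrow> plane \<Rightarrow> plane" where
  "reflection L x = 2 *\<^sub>R closest_point L x - x"

definition group_C :: "nat \<Rightarrow> plane \<Rightarrow> (plane \<Rightarrow> plane) set" where
  "group_C n c = generate (BijGroup UNIV) {rotation c (2 * pi / real n)}"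

definition group_Cv :: "nat \<Rightarrow> plane \<Rightarrow> plane set \<Rightarrow> (plane \<Rightarrow> plane) set" where
  "group_Cv n c L = generate (BijGroup UNIV) {rotation c (2 * pi / real n), reflection L}"

definition mirror_lines ::
  "('b::finite \<Rightarrow> 'j::finite set) \<Rightarrow> ('j \<Rightarrow> plane) \<Rightarrow> plane set set" where
  "mirror_lines ends p = {L. is_line L \<and> reflection L \<in> point_group ends p}"

definition joints_at :: "('j::finite \<Rightarrow> plane) \<Rightarrow> plane \<Rightarrow> 'j set" where
  "joints_at p c = {u. p u = c}"

definition unshifted_bars ::
  "('b::finite \<Rightarrow> 'j::finite set) \<Rightarrow> ('j \<Rightarrow> plane) \<Rightarrow> (plane \<Rightarrow> plane) \<Rightarrow> 'b set" where
  "unshifted_bars ends p g = {e. g ` p ` ends e = p ` ends e}"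

definition joint_orbit ::
  "('b::finite \<Rightarrow> 'j::finite set) \<Rightarrow> ('j \<Rightarrow> plane) \<Rightarrow> 'j \<Rightarrow> 'j set" where
  "joint_orbit ends p u = {v. \<exists>g \<in> point_group ends p. g (p u) = p v}"

definition bar_orbit ::
  "('b::finite \<Rightarrow> 'j::finite set) \<Rightarrow> ('j \<Rightarrow> plane) \<Rightarrow> 'b \<Rightarrow> 'b set" where
  "bar_orbit ends p e = {e'. \<exists>g \<in> point_group ends p. g ` p ` ends e = p ` ends e'}"

definition occur_in_sets_of :: "nat set \<Rightarrow> ('x \<Rightarrow> 'x set) \<Rightarrow> 'x set \<Rightarrow> bool" where
  "occur_in_sets_of K orb S \<longleftrightarrow> partition_on S (orb ` S) \<and> (\<forall>x \<in> S. card (orb x) \<in> K)"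

definition bar_segment ::
  "('b::finite \<Rightarrow> 'j::finite set) \<Rightarrow> ('j \<Rightarrow> plane) \<Rightarrow> 'b \<Rightarrow> plane set" where
  "bar_segment ends p e = convex hull (p ` ends e)"

definition perpendicular :: "plane set \<Rightarrow> plane set \<Rightarrow> bool" where
  "perpendicular S L \<longleftrightarrow> (\<forall>a\<in>S. \<forall>b\<in>S. \<forall>x\<in>L. \<forall>y\<in>L. orthogonal (a - b) (x - y))"

end

(* A framework with full row rank and only the rigid motions in the kernel of its compatibility
   matrix gives an isomorphism from joint displacements to bar extensions plus three coordinates
   (total displacement and total moment about the centroid of the joints).  Every element g of the
   point group fixes the centroid and commutes with this isomorphism, so the traces on both sides
   agree: with A the linear part of g,
     (number of fixed joints) * tr A = (number of fixed bars) + tr A + det A.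
   For a reflection this says that exactly one bar is fixed.  For a rotation by t other than the
   identity it says that no joint is at the centre and that cos t is -1 (with one fixed bar) or
   -1/2 (with none).  The rest is orbit counting in the resulting groups. *)

theory Submission
  imports Defs
begin

section \<open>The trace identity\<close>

text \<open>Without mechanisms and self-stresses, the representation on joint displacements is the
  sum of those on bar extensions and on rigid motions. Appending three rows to the compatibility
  matrix realises this by a single square map, since 2j = b + 3, so traces of conjugate maps are all
  that is compared and no kernel or quotient representation has to be formed. The terms tr A and det
  A are the characters of the translations and of the infinitesimal rotation.

  The appended rows must transform well under the whole group before anything is known about that
  group. This is why moments are taken about the centroid: it is a common fixed point that needs no
  classification, and later it turns out to be the rotation centre and to lie on every
  mirror.\<close>

lemma trace_eq_if_intertwined:
  fixes \<Phi> :: "real ^ 'n \<Rightarrow> real ^ 'm"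
  assumes "linear \<Phi>" "surj \<Phi>" "CARD('n) = CARD('m)" "linear f" "linear h"
    and comm: "\<And>x. \<Phi> (f x) = h (\<Phi> x)"
  shows "trace (matrix f) = trace (matrix h)"
proof -
  \<comment> \<open>Surjectivity means that the rank equals the number of rows; since the matrix is
    square, this is also the number of columns.\<close>
  have inj: "inj \<Phi>"
  proof -
    have "rank (matrix \<Phi>) = CARD('m)"
      using assms(1,2) by (simp add: full_rank_surjective)
    then show ?thesis
      using assms(1,3) full_rank_injective[of "matrix \<Phi>"] by simp
  qed
  obtain \<Psi> where \<Psi>: "linear \<Psi>" "\<Psi> \<circ> \<Phi> = id"
    using linear_injective_left_inverse[OF assms(1) inj] by blast
  then have right: "\<Phi> (\<Psi> y) = y" for y
    using assms(2) by (metis comp_apply id_apply surjD)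
  \<comment> \<open>\<open>f\<close> and \<open>h\<close> are products of the same two maps in
    opposite orders, which is the situation of \<open>trace_mul_sym\<close>.\<close>
  have f: "f = \<Psi> \<circ> (h \<circ> \<Phi>)"
    using \<Psi>(2) comm by (metis (no_types, lifting) comp_apply ext id_apply)
  have h: "h = (h \<circ> \<Phi>) \<circ> \<Psi>"
    using right by auto
  have hl: "linear (h \<circ> \<Phi>)"
    using assms linear_compose by blast
  have "trace (matrix f) = trace (matrix \<Psi> ** matrix (h \<circ> \<Phi>))"
    by (subst f, subst matrix_compose) (use hl \<Psi> in auto)
  also have "\<dots> = trace (matrix (h \<circ> \<Phi>) ** matrix \<Psi>)"
    by (rule trace_mul_sym)
  also have "\<dots> = trace (matrix h)"
    by (subst (2) h, subst matrix_compose) (use hl \<Psi> in auto)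
  finally show ?thesis .
qed

section \<open>Moments, quarter turns and isometries in the plane\<close>

definition cross2 :: "plane \<Rightarrow> plane \<Rightarrow> real" where
  "cross2 a b = a $ 1 * b $ 2 - a $ 2 * b $ 1"

text \<open>The velocity field of the infinitesimal rotation about the origin; it supplies the
  rotational rigid motion.\<close>

definition quarter_turn :: "plane \<Rightarrow> plane" where
  "quarter_turn a = vector [- a $ 2, a $ 1]"

lemma cross2_add_right: "cross2 a (b + c) = cross2 a b + cross2 a c"
  and cross2_scaleR_right: "cross2 a (k *\<^sub>R b) = k * cross2 a b"
  and cross2_quarter_turn: "cross2 a (quarter_turn a) = a \<bullet> a"
  by (simp_all add: cross2_def quarter_turn_def inner_vec_def sum_2 algebra_simps)

lemma cross2_sum_left: "cross2 (sum f S) c = (\<Sum>u\<in>S. cross2 (f u) c)"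
  by (simp add: cross2_def sum_distrib_left sum_distrib_right sum_subtractf)

lemma quarter_turn_diff: "quarter_turn (a - b) = quarter_turn a - quarter_turn b"
  by (simp add: quarter_turn_def vec_eq_iff forall_2)

lemma quarter_turn_sum: "quarter_turn (sum f S) = (\<Sum>u\<in>S. quarter_turn (f u))"
  by (simp add: quarter_turn_def vec_eq_iff forall_2 sum_negf)

lemma quarter_turn_0: "quarter_turn 0 = 0"
  by (simp add: quarter_turn_def vec_eq_iff forall_2)

lemma inner_quarter_turn: "a \<bullet> quarter_turn a = 0"
  by (simp add: quarter_turn_def inner_vec_def sum_2)

text \<open>Multiplicativity of the determinant for the matrix with columns \<open>a\<close> and
  \<open>b\<close>. It is why moments are multiplied by det A.\<close>

lemma cross2_matrix:
  "cross2 (A *v a) (A *v b) = det A * cross2 a b" for A :: "real ^ 2 ^ 2"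
  by (simp add: cross2_def det_2 matrix_vector_mult_def sum_2 algebra_simps)

text \<open>The base point \<open>c\<close> is left free with one linear part \<open>A\<close> for
  all of them, so that \<open>g\<close> can be expanded about the origin, the centroid or a fixed
  point as required.\<close>

lemma plane_isometry_affine:
  assumes "plane_isometry g"
  shows "\<exists>A. orthogonal_matrix A \<and> (\<forall>x c. g x = g c + A *v (x - c))"
proof -
  define f where "f = (\<lambda>x. g x - g 0)"
  have "orthogonal_transformation f"
    unfolding orthogonal_transformation_isometry f_def
    using assms by (simp add: plane_isometry_def dist_norm)
  then have f: "linear f" "orthogonal_matrix (matrix f)"
    by (auto simp: orthogonal_transformation_matrix)
  have "g x = g c + matrix f *v (x - c)" for x c
    using f(1) by (simp add: linear_diff) (simp add: f_def)
  with f(2) show ?thesis by blast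
qed

definition centroid :: "('j::finite \<Rightarrow> plane) \<Rightarrow> plane" where
  "centroid p = (1 / real CARD('j)) *\<^sub>R (\<Sum>u\<in>UNIV. p u)"

lemma sum_centroid_diff: "(\<Sum>u\<in>UNIV. p u - centroid p) = 0" for p :: "'j::finite \<Rightarrow> plane"
  by (simp add: centroid_def sum_subtractf sum_constant_scaleR del: sum_constant)

text \<open>The matrix has its columns indexed by pairs; this reads off the planar displacement of a
  single joint.\<close>

definition slot :: "real ^ ('j \<times> 2) \<Rightarrow> 'j::finite \<Rightarrow> plane" where
  "slot x u = (\<chi> i. x $ (u, i))"

lemma slot_add: "slot (x + y) u = slot x u + slot y u"
  and slot_scaleR: "slot (k *\<^sub>R x) u = k *\<^sub>R slot x u"
  by (simp_all add: slot_def vec_eq_iff)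

section \<open>Symmetries as permutations of joints and bars\<close>

locale bar_framework =
  fixes ends :: "'b::finite \<Rightarrow> 'j::finite set" and p :: "'j \<Rightarrow> plane"
  assumes card_ends: "card (ends e) = 2" and inj_ends: "inj ends" and inj_p: "inj p"
begin

lemma p_eq_iff [simp]: "p u = p v \<longleftrightarrow> u = v"
  using inj_p by (simp add: inj_eq)

lemma p_image_eq_iff [simp]: "p ` S = p ` T \<longleftrightarrow> S = T"
  using inj_p by (simp add: inj_image_eq_iff)

lemma ends_eq_iff [simp]: "ends e = ends e' \<longleftrightarrow> e = e'"
  using inj_ends by (simp add: inj_eq)

lemma bar_ends:
  obtains u v where "ends e = {u, v}" "u \<noteq> v"
  using card_ends[of e] by (auto simp: card_2_iff)

text \<open>The two end blocks of a row are opposite, so only the relative displacement along the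
  bar survives. The resulting expression is symmetric in \<open>u\<close> and \<open>v\<close>, so
  the ends may be named in either order.\<close>

lemma compat_matrix_mult:
  assumes e: "ends e = {u, v}" "u \<noteq> v"
  shows "(compat_matrix ends p *v x) $ e
    = (p u - p v) \<bullet> (slot x u - slot x v) / dist (p u) (p v)"
proof -
  have o: "other_end ends e u = v" "other_end ends e v = u"
    using e by (auto simp: other_end_def insert_Diff_if)
  have "(compat_matrix ends p *v x) $ e =
      (\<Sum>w\<in>UNIV. \<Sum>i\<in>UNIV. (if w \<in> {u, v}
        then (p w - p (other_end ends e w)) $ i / dist (p w) (p (other_end ends e w)) else 0) * x $ (w, i))"
    unfolding compat_matrix_def matrix_vector_mult_def
    by (simp add: e sum.cartesian_product UNIV_Times_UNIV[symmetric] case_prod_unfold del: UNIV_Times_UNIV)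
  also have "\<dots> = (\<Sum>w\<in>{u, v}. \<Sum>i\<in>UNIV. (p w - p (other_end ends e w)) $ i
        / dist (p w) (p (other_end ends e w)) * x $ (w, i))"
    by (rule sum.mono_neutral_cong_right) auto
  also have "\<dots> = (p u - p v) \<bullet> (slot x u - slot x v) / dist (p u) (p v)"
    using e(2) by (simp add: o sum_2 inner_vec_def slot_def dist_commute diff_divide_distrib
        add_divide_distrib algebra_simps)
  finally show ?thesis .
qed

lemma point_group_joint_permE:
  assumes "g \<in> point_group ends p"
  obtains \<pi> where "bij \<pi>" "\<And>u. g (p u) = p (\<pi> u)"
proof -
  have b: "bij_betw g (range p) (range p)"
    using assms by (simp add: point_group_def)
  then have "\<forall>u. \<exists>v. g (p u) = p v"
    by (auto simp: bij_betw_def)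
  then obtain \<pi> where \<pi>: "\<And>u. g (p u) = p (\<pi> u)"
    by metis
  have "inj \<pi>"
    by (rule injI) (metis \<pi> b bij_betw_inv_into_left inj_eq inj_p rangeI)
  then show thesis
    using that \<pi> finite_UNIV_inj_surj[of \<pi>] by (auto simp: bij_def)
qed

text \<open>A symmetry is only required to send bars to bars. Injectivity on bars comes from
  injectivity of \<open>g\<close>, \<open>p\<close> and \<open>ends\<close>, and finiteness turns it
  into a permutation.\<close>

lemma point_group_bar_permE:
  assumes "g \<in> point_group ends p"
  obtains \<beta> where "bij \<beta>" "\<And>e. g ` p ` ends e = p ` ends (\<beta> e)"
proof -
  have "\<forall>e. \<exists>e'. g ` p ` ends e = p ` ends e'"
    using assms by (simp add: point_group_def)
  then obtain \<beta> where \<beta>: "\<And>e. g ` p ` ends e = p ` ends (\<beta> e)"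
    by metis
  have "inj g"
    using assms by (auto simp: point_group_def plane_isometry_def bij_def)
  have "inj \<beta>"
    by (rule injI) (metis \<beta> \<open>inj g\<close> inj_image_eq_iff p_image_eq_iff ends_eq_iff)
  then show thesis
    using that \<beta> finite_UNIV_inj_surj[of \<beta>] by (auto simp: bij_def)
qed

text \<open>Affine maps commute with averages, and \<open>g\<close> merely permutes the averaged
  points.\<close>

lemma point_group_fixes_centroid:
  assumes "g \<in> point_group ends p"
  shows "g (centroid p) = centroid p"
proof -
  obtain \<pi> where \<pi>: "bij \<pi>" "\<And>u. g (p u) = p (\<pi> u)"
    using point_group_joint_permE assms by blast
  have "plane_isometry g"
    using assms by (simp add: point_group_def)
  then obtain A where A: "\<And>x c. g x = g c + A *v (x - c)"
    using plane_isometry_affine by blast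
  define c where "c = centroid p"
  have "(\<Sum>u\<in>UNIV. p (\<pi> u)) = (\<Sum>u\<in>UNIV. p u)"
    using \<pi>(1) by (rule sum.reindex_bij_betw)
  moreover have "(\<Sum>u\<in>UNIV. p (\<pi> u)) = (\<Sum>u\<in>UNIV. g c + A *v (p u - c))"
    by (intro sum.cong refl) (subst \<pi>(2)[symmetric], rule A)
  moreover have "\<dots> = real CARD('j) *\<^sub>R g c + A *v (\<Sum>u\<in>UNIV. p u - c)"
    by (simp add: sum.distrib sum_constant_scaleR linear_sum del: sum_constant)
  moreover have "(\<Sum>u\<in>UNIV. p u) = real CARD('j) *\<^sub>R c"
    by (simp add: c_def centroid_def)
  ultimately show ?thesis
    by (simp add: c_def sum_centroid_diff)
qed

end

section \<open>The extended compatibility map and the character identity\<close>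

locale isostatic_framework = bar_framework ends p
  for ends :: "'b::finite \<Rightarrow> 'j::finite set" and p :: "'j \<Rightarrow> plane" +
  assumes isostatic: "isostatic ends p"
begin

lemma card_bars: "CARD('b) + 3 = 2 * CARD('j)"
  and rank_compat_matrix: "rank (compat_matrix ends p) = CARD('b)"
  using isostatic by (auto simp: isostatic_def mechanism_count_def self_stress_count_def)

text \<open>As the centroid is fixed by every symmetry, the last three coordinates transform without
  mixing: the total displacement by A and the moment by det A.\<close>

definition \<Phi> :: "real ^ ('j \<times> 2) \<Rightarrow> real ^ ('b + 3)" where
  "\<Phi> x = (\<chi> r. case r of Inl e \<Rightarrow> (compat_matrix ends p *v x) $ e
     | Inr i \<Rightarrow> vector [(\<Sum>u\<in>UNIV. slot x u) $ 1, (\<Sum>u\<in>UNIV. slot x u) $ 2,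
         \<Sum>u\<in>UNIV. cross2 (p u - centroid p) (slot x u)] $ i)"

lemma \<Phi>_eq_iff:
  "\<Phi> x = y \<longleftrightarrow> (\<forall>e. (compat_matrix ends p *v x) $ e = y $ Inl e)
     \<and> (\<Sum>u\<in>UNIV. slot x u) $ 1 = y $ Inr 1 \<and> (\<Sum>u\<in>UNIV. slot x u) $ 2 = y $ Inr 2
     \<and> (\<Sum>u\<in>UNIV. cross2 (p u - centroid p) (slot x u)) = y $ Inr 3"
  by (auto simp: \<Phi>_def vec_eq_iff forall_3 vector_3 split: sum.splits)

lemma \<Phi>_nth [simp]:
  "\<Phi> x $ Inl e = (compat_matrix ends p *v x) $ e"
  "\<Phi> x $ Inr 1 = (\<Sum>u\<in>UNIV. slot x u) $ 1"
  "\<Phi> x $ Inr 2 = (\<Sum>u\<in>UNIV. slot x u) $ 2"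
  "\<Phi> x $ Inr 3 = (\<Sum>u\<in>UNIV. cross2 (p u - centroid p) (slot x u))"
  by (simp_all add: \<Phi>_def vector_3)

lemma linear_\<Phi>: "linear \<Phi>"
proof (rule linearI)
  show "\<Phi> (x + y) = \<Phi> x + \<Phi> y" for x y
    by (simp add: \<Phi>_eq_iff matrix_vector_right_distrib slot_add sum.distrib cross2_add_right)
  show "\<Phi> (k *\<^sub>R x) = k *\<^sub>R \<Phi> x" for k x
    by (simp add: \<Phi>_eq_iff matrix_vector_mult_scaleR slot_scaleR cross2_scaleR_right sum_distrib_left)
qed

text \<open>Bar extensions can be prescribed arbitrarily because the compatibility matrix has full row
  rank; the rigid motions \<open>t + \<omega> J (p u - c)\<close> in its kernel then adjust the other three entries.\<close>
lemma surj_\<Phi>: "surj \<Phi>"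
proof -
  have "\<exists>x. \<Phi> x = y" for y
  proof -
    define c where "c = centroid p"
    define q where "q u = p u - c" for u
    define Q where "Q = (\<Sum>u\<in>UNIV. q u \<bullet> q u)"
    have q0: "(\<Sum>u\<in>UNIV. q u) = 0"
      by (simp add: q_def c_def sum_centroid_diff)
    \<comment> \<open>A bar exists because types are nonempty, and its two distinct ends cannot both
      be at the centroid. So \<open>Q\<close>, the divisor in \<omega>, is positive.\<close>
    obtain u v where uv: "ends (undefined::'b) = {u, v}" "u \<noteq> v"
      by (rule bar_ends)
    then have "q u \<noteq> 0 \<or> q v \<noteq> 0"
      using inj_p by (auto simp: q_def)
    then have Q: "Q > 0"
      unfolding Q_def by (metis (no_types) UNIV_I finite inner_ge_zero inner_gt_zero_iff sum_pos2)
    have "surj ((*v) (compat_matrix ends p))"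
      using rank_compat_matrix full_rank_surjective by blast
    then obtain x0 where x0: "compat_matrix ends p *v x0 = (\<chi> e. y $ Inl e)"
      by (metis surjD)
    \<comment> \<open>\<open>t\<close> is the missing total displacement per joint, \<omega> the
      missing moment divided by \<open>Q\<close>. The two corrections do not interfere because the
      vectors \<open>q u\<close> sum to zero: the rotation adds no total displacement and the
      translation adds no moment.\<close>
    define t :: plane where
      "t = (1 / real CARD('j)) *\<^sub>R (vector [y $ Inr 1, y $ Inr 2] - (\<Sum>u\<in>UNIV. slot x0 u))"
    define \<omega> where "\<omega> = (y $ Inr 3 - (\<Sum>u\<in>UNIV. cross2 (q u) (slot x0 u))) / Q"
    define k :: "real ^ ('j \<times> 2)" where "k = (\<chi> c. (t + \<omega> *\<^sub>R quarter_turn (q (fst c))) $ snd c)"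
    have k: "slot k u = t + \<omega> *\<^sub>R quarter_turn (q u)" for u
      by (simp add: slot_def k_def vec_eq_iff)
    have "(compat_matrix ends p *v k) $ e = 0" for e
    proof -
      obtain u v where uv: "ends e = {u, v}" "u \<noteq> v"
        by (rule bar_ends)
      have "slot k u - slot k v = \<omega> *\<^sub>R quarter_turn (p u - p v)"
        by (simp add: k q_def quarter_turn_diff scaleR_diff_right)
      then show ?thesis
        by (simp add: compat_matrix_mult[OF uv] inner_quarter_turn)
    qed
    moreover have "(\<Sum>u\<in>UNIV. slot k u) = real CARD('j) *\<^sub>R t"
      using q0 by (simp add: k sum.distrib sum_constant_scaleR scaleR_sum_right[symmetric]
          quarter_turn_sum[symmetric] quarter_turn_0 del: sum_constant)
    moreover have "(\<Sum>u\<in>UNIV. cross2 (q u) (slot k u)) = \<omega> * Q"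
    proof -
      have "(\<Sum>u\<in>UNIV. cross2 (q u) t) = 0"
        unfolding cross2_sum_left[symmetric] q0 by (simp add: cross2_def)
      then show ?thesis
        by (simp add: k cross2_add_right cross2_scaleR_right cross2_quarter_turn sum.distrib Q_def
          sum_distrib_left)
    qed
    ultimately have "\<Phi> (x0 + k) = y"
      using Q unfolding \<Phi>_eq_iff q_def[symmetric] c_def[symmetric]
      by (simp add: matrix_vector_right_distrib x0 slot_add sum.distrib cross2_add_right t_def \<omega>_def)
    then show ?thesis ..
  qed
  then show ?thesis
    by (metis surjI)
qed

text \<open>Both sides are traces of the action of \<open>g\<close>. A joint or bar that is moved
  puts its block off the diagonal, so only fixed ones are counted: tr A for each fixed joint, 1 for
  each fixed bar.\<close>

lemma point_group_character:
  assumes g: "g \<in> point_group ends p" and A: "\<And>x. g x = a + A *v x"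
  shows "real (card {u. g (p u) = p u}) * trace A
    = real (card (unshifted_bars ends p g)) + trace A + det A"
proof -
  obtain \<pi> where \<pi>: "bij \<pi>" "\<And>u. g (p u) = p (\<pi> u)"
    using point_group_joint_permE g by blast
  obtain \<beta> where \<beta>: "bij \<beta>" "\<And>e. g ` p ` ends e = p ` ends (\<beta> e)"
    using point_group_bar_permE g by blast
  define c where "c = centroid p"
  have gc: "g c = c"
    using point_group_fixes_centroid g by (simp add: c_def)
  have gA: "g x - g y = A *v (x - y)" for x y
    by (simp add: A matrix_vector_mult_diff_distrib)
  have gA': "p (\<pi> u) - p (\<pi> v) = A *v (p u - p v)" for u v
    using gA[of "p u" "p v"] by (simp add: \<pi>(2))
  have gA'': "p (\<pi> u) - c = A *v (p u - c)" for u
    using gA[of "p u" c] by (simp add: gc \<pi>(2))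
  have iso: "plane_isometry g"
    using g by (simp add: point_group_def)
  then have dist_g: "dist (g x) (g y) = dist x y" for x y
    by (simp add: plane_isometry_def)
  have "norm (A *v x) = norm x" for x
    using dist_g[of x 0] gA[of x 0] by (simp add: dist_norm)
  then have "orthogonal_transformation ((*v) A)"
    by (simp add: orthogonal_transformation)
  then have A_inner: "(A *v x) \<bullet> (A *v y) = x \<bullet> y" for x y
    by (simp add: orthogonal_transformation_def)

  \<comment> \<open>A joint receives the turned displacement of the joint it comes from, hence the
    inverse permutation.\<close>
  define f :: "real ^ ('j \<times> 2) \<Rightarrow> real ^ ('j \<times> 2)"
    where "f x = (\<chi> c. (A *v slot x (inv_into UNIV \<pi> (fst c))) $ snd c)" for x
  \<comment> \<open>Extensions are scalars, so they are permuted without being turned.\<close>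
  define h :: "real ^ ('b + 3) \<Rightarrow> real ^ ('b + 3)"
    where "h y = (\<chi> r. case r of Inl e \<Rightarrow> y $ Inl (inv_into UNIV \<beta> e)
      | Inr i \<Rightarrow> vector [A $ 1 $ 1 * y $ Inr 1 + A $ 1 $ 2 * y $ Inr 2,
          A $ 2 $ 1 * y $ Inr 1 + A $ 2 $ 2 * y $ Inr 2, det A * y $ Inr 3] $ i)" for y
  have h_nth: "h y $ Inl e = y $ Inl (inv_into UNIV \<beta> e)"
    "h y $ Inr 1 = A $ 1 $ 1 * y $ Inr 1 + A $ 1 $ 2 * y $ Inr 2"
    "h y $ Inr 2 = A $ 2 $ 1 * y $ Inr 1 + A $ 2 $ 2 * y $ Inr 2"
    "h y $ Inr 3 = det A * y $ Inr 3" for y e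
    by (simp_all add: h_def vector_3)
  have h_linear: "linear h"
    by (rule linearI) (auto simp: h_def vec_eq_iff forall_3 vector_3 algebra_simps split: sum.splits)
  have f_linear: "linear f"
    by (rule linearI) (auto simp: f_def vec_eq_iff slot_add slot_scaleR matrix_vector_right_distrib
        matrix_vector_mult_scaleR)
  have slot_f: "slot (f x) u = A *v slot x (inv_into UNIV \<pi> u)" for x u
    unfolding slot_def[of "f x"] by (simp add: f_def vec_eq_iff)
  have slot_f_\<pi>: "slot (f x) (\<pi> u) = A *v slot x u" for x u
    using \<pi>(1) by (simp add: slot_f bij_is_inj)
  have "\<Phi> (f x) = h (\<Phi> x)" for x
    unfolding \<Phi>_eq_iff h_nth
  proof (intro conjI allI)
    fix e
    \<comment> \<open>With the bar written as the image of \<open>e0\<close>, both factors of the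
      inner product carry the orthogonal matrix \<open>A\<close>, which therefore cancels.\<close>
    obtain e0 where e0: "e = \<beta> e0"
      using \<beta>(1) by (metis bij_pointE)
    obtain u v where uv: "ends e0 = {u, v}" "u \<noteq> v"
      by (rule bar_ends)
    have "p ` ends e = p ` {\<pi> u, \<pi> v}"
      using \<beta>(2)[of e0] uv \<pi>(2) e0 by simp
    then have e: "ends e = {\<pi> u, \<pi> v}"
      by (simp only: p_image_eq_iff)
    have ne: "\<pi> u \<noteq> \<pi> v"
      using uv(2) \<pi>(1) by (simp add: bij_is_inj inj_eq)
    have "dist (p (\<pi> u)) (p (\<pi> v)) = dist (p u) (p v)"
      by (metis \<pi>(2) dist_g)
    then show "(compat_matrix ends p *v f x) $ e = \<Phi> x $ Inl (inv_into UNIV \<beta> e)"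
      using \<beta>(1) compat_matrix_mult[OF e ne, of "f x"]
      by (simp add: compat_matrix_mult[OF uv] e0 bij_is_inj slot_f_\<pi> gA' A_inner matrix_vector_mult_diff_distrib[symmetric])
  next
    have "(\<Sum>u\<in>UNIV. slot (f x) u) = (\<Sum>u\<in>UNIV. slot (f x) (\<pi> u))"
      using sum.reindex_bij_betw[OF \<pi>(1)] by metis
    then have s: "(\<Sum>u\<in>UNIV. slot (f x) u) = A *v (\<Sum>u\<in>UNIV. slot x u)"
      by (simp add: slot_f_\<pi> linear_sum)
    show "(\<Sum>u\<in>UNIV. slot (f x) u) $ 1 = A $ 1 $ 1 * \<Phi> x $ Inr 1 + A $ 1 $ 2 * \<Phi> x $ Inr 2"
      "(\<Sum>u\<in>UNIV. slot (f x) u) $ 2 = A $ 2 $ 1 * \<Phi> x $ Inr 1 + A $ 2 $ 2 * \<Phi> x $ Inr 2"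
      unfolding s \<Phi>_nth by (simp_all only: matrix_vector_mult_def sum_2 vec_lambda_beta)
    have "(\<Sum>u\<in>UNIV. cross2 (p u - c) (slot (f x) u))
        = (\<Sum>u\<in>UNIV. cross2 (p (\<pi> u) - c) (slot (f x) (\<pi> u)))"
      using sum.reindex_bij_betw[OF \<pi>(1), of "\<lambda>u. cross2 (p u - c) (slot (f x) u)"] by simp
    then show "(\<Sum>u\<in>UNIV. cross2 (p u - centroid p) (slot (f x) u)) = det A * \<Phi> x $ Inr 3"
      unfolding c_def[symmetric] \<Phi>_nth
      by (simp add: slot_f_\<pi> gA'' cross2_matrix sum_distrib_left)
  qed
  then have "trace (matrix f) = trace (matrix h)"
    using trace_eq_if_intertwined[OF linear_\<Phi> surj_\<Phi> _ f_linear h_linear] card_bars by simp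
  moreover have "trace (matrix f) = real (card {u. g (p u) = p u}) * trace A"
  proof -
    have s: "slot (axis (u, i) 1) v = (if v = u then axis i 1 else 0)" for u v :: 'j and i :: 2
      by (auto simp: slot_def axis_def vec_eq_iff)
    have iff: "inv_into UNIV \<pi> u = u \<longleftrightarrow> g (p u) = p u" for u
      using \<pi> by (metis bij_inv_eq_iff p_eq_iff)
    \<comment> \<open>The diagonal entry at \<open>(u, i)\<close> is found by applying
      \<open>f\<close> to a basis vector supported on \<open>u\<close>; it vanishes unless \<pi>
      fixes \<open>u\<close>, and is then the entry \<open>A $ i $ i\<close>.\<close>
    have "trace (matrix f) = (\<Sum>u\<in>UNIV. \<Sum>i\<in>UNIV. f (axis (u, i) 1) $ (u, i))"
      by (simp add: trace_def matrix_def sum.cartesian_product UNIV_Times_UNIV[symmetric]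
          case_prod_unfold del: UNIV_Times_UNIV)
    also have "\<dots> = (\<Sum>u\<in>UNIV. if g (p u) = p u then trace A else 0)"
      by (rule sum.cong)
        (auto simp: f_def s iff trace_def matrix_vector_mul_component inner_axis)
    also have "\<dots> = real (card {u. g (p u) = p u}) * trace A"
      by (simp add: sum.If_cases)
    finally show ?thesis .
  qed
  moreover have "trace (matrix h) = real (card (unshifted_bars ends p g)) + trace A + det A"
  proof -
    have iff: "inv_into UNIV \<beta> e = e \<longleftrightarrow> e \<in> unshifted_bars ends p g" for e
      unfolding unshifted_bars_def using \<beta> by (metis (mono_tags) bij_inv_eq_iff ends_eq_iff mem_Collect_eq p_image_eq_iff)
    have "trace (matrix h) = (\<Sum>e\<in>UNIV. h (axis (Inl e) 1) $ Inl e) + (\<Sum>i\<in>UNIV. h (axis (Inr i) 1) $ Inr i)"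
      by (simp add: trace_def matrix_def UNIV_Plus_UNIV[symmetric] sum.Plus del: UNIV_Plus_UNIV)
    also have "(\<Sum>e\<in>UNIV. h (axis (Inl e) 1) $ Inl e)
        = (\<Sum>e\<in>UNIV. if e \<in> unshifted_bars ends p g then 1 else 0)"
      by (rule sum.cong) (auto simp: h_nth axis_def iff[symmetric])
    also have "\<dots> = real (card (unshifted_bars ends p g))"
      by (simp add: sum.If_cases)
    also have "(\<Sum>i\<in>UNIV. h (axis (Inr i) 1) $ Inr i) = trace A + det A"
      by (simp add: sum_3 h_nth axis_def trace_def sum_2)
    finally show ?thesis by simp
  qed
  ultimately show ?thesis by simp
qed

end

section \<open>Rotations and reflections of the plane\<close>

text \<open>The parameter is twice the angle of the axis, so that products with rotations and other
  mirrors only add or subtract parameters. The axis itself has the direction of angle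
  \<open>t / 2\<close>.\<close>

definition mirror :: "plane \<Rightarrow> real \<Rightarrow> plane \<Rightarrow> plane" where
  "mirror c t x = c + vector [vector [cos t, sin t], vector [sin t, - cos t]] *v (x - c)"

definition axis_line :: "plane \<Rightarrow> real \<Rightarrow> plane set" where
  "axis_line c t = range (\<lambda>k. c + k *\<^sub>R vector [cos (t / 2), sin (t / 2)])"

lemma rotation_nth:
  "rotation c t x $ 1 = c $ 1 + cos t * (x $ 1 - c $ 1) - sin t * (x $ 2 - c $ 2)"
  "rotation c t x $ 2 = c $ 2 + sin t * (x $ 1 - c $ 1) + cos t * (x $ 2 - c $ 2)"
  by (simp_all add: rotation_def matrix_vector_mult_def sum_2)

lemma mirror_nth:
  "mirror c t x $ 1 = c $ 1 + cos t * (x $ 1 - c $ 1) + sin t * (x $ 2 - c $ 2)"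
  "mirror c t x $ 2 = c $ 2 + sin t * (x $ 1 - c $ 1) - cos t * (x $ 2 - c $ 2)"
  by (simp_all add: mirror_def matrix_vector_mult_def sum_2)

lemma rotation_0 [simp]: "rotation c 0 = id"
  by (rule ext) (simp add: vec_eq_iff forall_2 rotation_nth)

lemma rotation_comp_rotation: "rotation c s \<circ> rotation c t = rotation c (s + t)"
  by (rule ext) (simp add: vec_eq_iff forall_2 rotation_nth cos_add sin_add algebra_simps)

lemma rotation_comp_mirror: "rotation c s \<circ> mirror c t = mirror c (s + t)"
  by (rule ext)
    (simp add: vec_eq_iff forall_2 rotation_nth mirror_nth cos_add sin_add algebra_simps)

lemma mirror_comp_rotation: "mirror c s \<circ> rotation c t = mirror c (s - t)"
  by (rule ext)
    (simp add: vec_eq_iff forall_2 rotation_nth mirror_nth cos_diff sin_diff algebra_simps)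

lemma mirror_comp_mirror: "mirror c s \<circ> mirror c t = rotation c (s - t)"
  by (rule ext)
    (simp add: vec_eq_iff forall_2 rotation_nth mirror_nth cos_diff sin_diff algebra_simps)

lemma rotation_comp_uminus: "rotation c t \<circ> rotation c (- t) = id"
  "rotation c (- t) \<circ> rotation c t = id"
  by (simp_all add: rotation_comp_rotation)

lemma mirror_comp_self: "mirror c t \<circ> mirror c t = id"
  by (simp add: mirror_comp_mirror)

lemma bij_rotation: "bij (rotation c t)"
  using o_bij rotation_comp_uminus by blast

lemma bij_mirror: "bij (mirror c t)"
  using o_bij mirror_comp_self by blast

lemma rotation_cong: "cos s = cos t \<Longrightarrow> sin s = sin t \<Longrightarrow> rotation c s = rotation c t"
  by (rule ext) (simp add: rotation_def)

lemma mirror_cong: "cos s = cos t \<Longrightarrow> sin s = sin t \<Longrightarrow> mirror c s = mirror c t"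
  by (rule ext) (simp add: mirror_def)

lemma rotation_fixed_iff: "rotation c t x = x \<longleftrightarrow> x = c \<or> cos t = 1"
proof
  define a where "a = x $ 1 - c $ 1"
  define b where "b = x $ 2 - c $ 2"
  assume "rotation c t x = x"
  then have "a = cos t * a - sin t * b" "b = sin t * a + cos t * b"
    by (simp_all add: vec_eq_iff forall_2 rotation_nth a_def b_def)
  \<comment> \<open>Multiply the first equation by \<open>a\<close>, the second by \<open>b\<close>,
    and add; the sine terms cancel.\<close>
  then have "(1 - cos t) * (a\<^sup>2 + b\<^sup>2) = 0"
    by algebra
  then have "cos t = 1 \<or> a = 0 \<and> b = 0"
    by (simp add: sum_power2_eq_zero_iff)
  then show "x = c \<or> cos t = 1"
    by (auto simp: vec_eq_iff forall_2 a_def b_def)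
next
  assume "x = c \<or> cos t = 1"
  moreover have "cos t = 1 \<Longrightarrow> sin t = 0"
    using sin_cos_squared_add[of t] by simp
  ultimately show "rotation c t x = x"
    by (auto simp: vec_eq_iff forall_2 rotation_nth)
qed

lemma unit_inner_self: "vector [cos s, sin s] \<bullet> (vector [cos s, sin s] :: plane) = 1"
  by (simp add: inner_vec_def sum_2 power2_eq_square[symmetric])

text \<open>The double angle formulas rewrite the mirror matrix as twice the projection onto
  \<open>v\<close> minus the identity.\<close>

lemma mirror_eq_projection:
  fixes c x :: plane and t :: real
  defines "v \<equiv> vector [cos (t / 2), sin (t / 2)]"
  shows "mirror c t x = 2 *\<^sub>R (c + ((x - c) \<bullet> v) *\<^sub>R v) - x"
proof -
  have "cos t = (cos (t / 2))\<^sup>2 - (sin (t / 2))\<^sup>2" "sin t = 2 * sin (t / 2) * cos (t / 2)"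
    using cos_double[of "t / 2"] sin_double[of "t / 2"] by simp_all
  moreover have "(cos (t / 2))\<^sup>2 + (sin (t / 2))\<^sup>2 = 1"
    by simp
  ultimately have "cos t = 2 * (cos (t / 2))\<^sup>2 - 1" "cos t = 1 - 2 * (sin (t / 2))\<^sup>2"
      "sin t = 2 * sin (t / 2) * cos (t / 2)"
    by linarith+
  note eqs = this
  show ?thesis
    unfolding vec_eq_iff forall_2 mirror_nth
  proof
    show "c $ 1 + cos t * (x $ 1 - c $ 1) + sin t * (x $ 2 - c $ 2)
        = (2 *\<^sub>R (c + ((x - c) \<bullet> v) *\<^sub>R v) - x) $ 1"
      unfolding eqs(1,3) by (simp add: v_def inner_vec_def sum_2 algebra_simps power2_eq_square)
    show "c $ 2 + sin t * (x $ 1 - c $ 1) - cos t * (x $ 2 - c $ 2)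
        = (2 *\<^sub>R (c + ((x - c) \<bullet> v) *\<^sub>R v) - x) $ 2"
      unfolding eqs(2,3) by (simp add: v_def inner_vec_def sum_2 algebra_simps power2_eq_square)
  qed
qed

section \<open>Lines, reflections and their fixed points\<close>

lemma axis_line_affine_hull:
  "axis_line c t = affine hull {c, c + vector [cos (t / 2), sin (t / 2)]}"
  by (simp add: axis_line_def affine_hull_2_alt)

lemma is_line_axis_line: "is_line (axis_line c t)"
proof -
  have "(vector [cos (t / 2), sin (t / 2)] :: plane) \<noteq> 0"
    using unit_inner_self[of "t / 2"] by (metis inner_zero_left zero_neq_one)
  then show ?thesis
    by (simp add: is_line_def axis_line_affine_hull)
qed

lemma center_in_axis_line: "c \<in> axis_line c t"
  by (auto simp: axis_line_def intro: range_eqI[of _ _ 0])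

text \<open>Any point of a line may be its base point, so all mirrors can be parametrised from one
  common centre. The direction to a second point is normalised to \<open>(cos s, sin s)\<close>; the
  parameter is then \<open>2 * s\<close>.\<close>

lemma line_as_axis_lineE:
  assumes L: "is_line L" and c: "c \<in> L"
  obtains t where "L = axis_line c t"
proof -
  have "L \<noteq> {c}"
    using L by (auto simp: is_line_def)
  then obtain w where w: "w \<in> L" "w \<noteq> c"
    using c by blast
  define r where "r = norm (w - c)"
  have r: "r > 0"
    using w by (simp add: r_def)
  have rr: "r\<^sup>2 = ((w - c) $ 1)\<^sup>2 + ((w - c) $ 2)\<^sup>2"
    unfolding r_def power2_norm_eq_inner by (simp add: inner_vec_def sum_2 power2_eq_square)
  have "((w - c) $ 1 / r)\<^sup>2 + ((w - c) $ 2 / r)\<^sup>2 = 1"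
    unfolding power_divide add_divide_distrib[symmetric] rr[symmetric] using r by simp
  then obtain s where s: "(w - c) $ 1 / r = cos s" "(w - c) $ 2 / r = sin s"
    using sincos_total_2pi by metis
  define v :: plane where "v = vector [cos s, sin s]"
  have wv: "w - c = r *\<^sub>R v"
    using s r by (simp add: vec_eq_iff forall_2 v_def field_simps)
  have "L = affine hull {c, w}"
  proof (rule affine_dim_equal[symmetric])
    show "affine hull {c, w} \<subseteq> L"
      using L c w by (simp add: hull_minimal is_line_def)
  qed (use L w in \<open>auto simp: is_line_def\<close>)
  also have "\<dots> = range (\<lambda>u. c + u *\<^sub>R (r *\<^sub>R v))"
    by (simp add: affine_hull_2_alt wv)
  also have "\<dots> = axis_line c (2 * s)"
  proof -
    have "c + k *\<^sub>R v \<in> range (\<lambda>u. c + u *\<^sub>R (r *\<^sub>R v))" for k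
      using r by (auto intro: range_eqI[of _ _ "k / r"])
    then show ?thesis
      by (auto simp: axis_line_def v_def[symmetric])
  qed
  finally show thesis
    by (rule that)
qed

lemma reflection_axis_line: "reflection (axis_line c t) = mirror c t"
proof
  fix x
  define v :: plane where "v = vector [cos (t / 2), sin (t / 2)]"
  define d where "d = x - c"
  have vv: "v \<bullet> v = 1"
    by (simp add: v_def unit_inner_self)
  have aff: "affine (axis_line c t)"
    using is_line_axis_line by (simp add: is_line_def)
  have "c + (d \<bullet> v) *\<^sub>R v = closest_point (axis_line c t) x"
  proof (rule closest_point_unique)
    show "convex (axis_line c t)" "closed (axis_line c t)"
      using aff by (simp_all add: affine_imp_convex affine_closed)
    show "c + (d \<bullet> v) *\<^sub>R v \<in> axis_line c t"
      by (auto simp: axis_line_def v_def)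
    show "\<forall>z\<in>axis_line c t. dist x (c + (d \<bullet> v) *\<^sub>R v) \<le> dist x z"
    proof
      fix z assume "z \<in> axis_line c t"
      then obtain k where z: "z = c + k *\<^sub>R v"
        by (auto simp: axis_line_def v_def)
      \<comment> \<open>The squared distance is a monic quadratic in the position \<open>h\<close>
        along the line, so its minimum is at \<open>h = d \<bullet> v\<close>.\<close>
      have sq: "(dist x (c + h *\<^sub>R v))\<^sup>2 = d \<bullet> d - 2 * h * (d \<bullet> v) + h\<^sup>2" for h
      proof -
        have "dist x (c + h *\<^sub>R v) = norm (d - h *\<^sub>R v)"
          by (simp add: dist_norm d_def algebra_simps)
        moreover have "(norm (d - h *\<^sub>R v))\<^sup>2 = d \<bullet> d - 2 * h * (d \<bullet> v) + h\<^sup>2"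
          unfolding power2_norm_eq_inner
          using vv by (simp add: inner_diff_left inner_diff_right inner_commute power2_eq_square)
        ultimately show ?thesis
          by simp
      qed
      have "0 \<le> (k - d \<bullet> v)\<^sup>2"
        by simp
      then have "(dist x (c + (d \<bullet> v) *\<^sub>R v))\<^sup>2 \<le> (dist x z)\<^sup>2"
        unfolding z sq by (simp add: power2_eq_square algebra_simps)
      then show "dist x (c + (d \<bullet> v) *\<^sub>R v) \<le> dist x z"
        by (rule power2_le_imp_le) simp
    qed
  qed
  then show "reflection (axis_line c t) x = mirror c t x"
    by (simp add: reflection_def mirror_eq_projection v_def d_def)
qed

lemma reflection_fixed_iff:
  assumes "is_line L"
  shows "reflection L x = x \<longleftrightarrow> x \<in> L"
proof -
  have "closed L" "L \<noteq> {}"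
    using assms by (auto simp: is_line_def affine_closed)
  moreover have "reflection L x = x \<longleftrightarrow> closest_point L x = x"
    by (auto simp: reflection_def vec_eq_iff forall_2)
  ultimately show ?thesis
    by (metis closest_point_in_set closest_point_self)
qed

lemma reflection_eq_iff:
  assumes "is_line L" "is_line M"
  shows "reflection L = reflection M \<longleftrightarrow> L = M"
proof
  assume "reflection L = reflection M"
  then show "L = M"
    using reflection_fixed_iff[OF assms(1)] reflection_fixed_iff[OF assms(2)] by auto
qed simp

lemma mirror_fixed_iff: "mirror c t x = x \<longleftrightarrow> x \<in> axis_line c t"
  by (simp add: is_line_axis_line reflection_axis_line[symmetric] reflection_fixed_iff)

text \<open>Compare fixed points: those of a rotation form a single point or the whole plane, those
  of a reflection a line.\<close>

lemma reflection_ne_rotation: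
  assumes "is_line L"
  shows "reflection L \<noteq> rotation c t"
proof
  assume "reflection L = rotation c t"
  then have "x \<in> L \<longleftrightarrow> x = c \<or> cos t = 1" for x
    using assms reflection_fixed_iff rotation_fixed_iff by metis
  then have "L = {c} \<or> L = UNIV"
    by auto
  then show False
    using assms by (auto simp: is_line_def)
qed

lemma mirror_ne_rotation: "mirror c t \<noteq> rotation c' t'"
  using reflection_ne_rotation[OF is_line_axis_line] by (simp add: reflection_axis_line)

lemma rotation_eq_iff: "rotation c s = rotation c t \<longleftrightarrow> cos s = cos t \<and> sin s = sin t"
proof
  assume "rotation c s = rotation c t"
  then have "rotation c s (c + axis 1 1) = rotation c t (c + axis 1 1)"
    by simp
  then show "cos s = cos t \<and> sin s = sin t"
    by (simp add: vec_eq_iff forall_2 rotation_nth axis_def)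
qed (blast intro: rotation_cong)

lemma mirror_eq_iff: "mirror c s = mirror c t \<longleftrightarrow> cos s = cos t \<and> sin s = sin t"
proof
  assume "mirror c s = mirror c t"
  then have "mirror c s (c + axis 1 1) = mirror c t (c + axis 1 1)"
    by simp
  then show "cos s = cos t \<and> sin s = sin t"
    by (simp add: vec_eq_iff forall_2 mirror_nth axis_def)
qed (blast intro: mirror_cong)

text \<open>Adding \<open>pi\<close> to the doubled angle turns the axis through a right
  angle.\<close>

lemma perpendicular_axis_lines: "perpendicular (axis_line c t) (axis_line c (t + pi))"
proof -
  have "cos ((t + pi) / 2) = - sin (t / 2)" "sin ((t + pi) / 2) = cos (t / 2)"
    by (simp_all add: add_divide_distrib cos_add sin_add)
  then show ?thesis
    by (auto simp: perpendicular_def axis_line_def orthogonal_def inner_vec_def sum_2 algebra_simps)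
qed

section \<open>Isometries with a fixed point are rotations or mirrors\<close>

lemma orthogonal_matrix_planeE:
  fixes A :: "real ^ 2 ^ 2"
  assumes "orthogonal_matrix A"
  obtains t where "A = vector [vector [cos t, - sin t], vector [sin t, cos t]]
    \<or> A = vector [vector [cos t, sin t], vector [sin t, - cos t]]"
proof -
  define a b c d where "a = A $ 1 $ 1" and "b = A $ 2 $ 1" and "c = A $ 1 $ 2" and "d = A $ 2 $ 2"
  have "(transpose A ** A) $ 1 $ 1 = 1" "(transpose A ** A) $ 1 $ 2 = 0"
      "(transpose A ** A) $ 2 $ 2 = 1"
    using assms by (simp_all add: orthogonal_matrix mat_def)
  then have 1: "a\<^sup>2 + b\<^sup>2 = 1" and 2: "a * c + b * d = 0" and 3: "c\<^sup>2 + d\<^sup>2 = 1"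
    by (simp_all add: matrix_matrix_mult_def transpose_def sum_2 a_def b_def c_def d_def
        power2_eq_square)
  obtain t where t: "a = cos t" "b = sin t"
    using 1 sincos_total_2pi by metis
  \<comment> \<open>The determinant. The second column turns out to be \<open>k\<close> times the
    quarter turn of the first, and its unit length leaves only \<open>k = 1\<close> (rotation) and
    \<open>k = - 1\<close> (mirror).\<close>
  define k where "k = a * d - b * c"
  have "c = - k * b"
  proof -
    have "c = (a\<^sup>2 + b\<^sup>2) * c - a * (a * c + b * d)"
      using 1 2 by simp
    then show ?thesis
      by (simp add: k_def algebra_simps power2_eq_square)
  qed
  moreover have "d = k * a"
  proof -
    have "d = (a\<^sup>2 + b\<^sup>2) * d - b * (a * c + b * d)"
      using 1 2 by simp
    then show ?thesis
      by (simp add: k_def algebra_simps power2_eq_square)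
  qed
  moreover have "k = 1 \<or> k = - 1"
  proof -
    have "k\<^sup>2 * (a\<^sup>2 + b\<^sup>2) = 1"
      using 3 calculation by (simp add: algebra_simps power_mult_distrib)
    then show ?thesis
      by (simp add: 1 power2_eq_1_iff)
  qed
  ultimately have "c = - b \<and> d = a \<or> c = b \<and> d = - a"
    by auto
  then have "A = vector [vector [cos t, - sin t], vector [sin t, cos t]]
    \<or> A = vector [vector [cos t, sin t], vector [sin t, - cos t]]"
    using t by (auto simp: vec_eq_iff forall_2 a_def b_def c_def d_def)
  then show thesis
    by (rule that)
qed

lemma plane_isometry_fixing_pointE:
  assumes "plane_isometry g" "g c = c"
  obtains t where "g = rotation c t \<or> g = mirror c t"
proof -
  obtain A where A: "orthogonal_matrix A" "\<And>x y. g x = g y + A *v (x - y)"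
    using plane_isometry_affine[OF assms(1)] by blast
  obtain t where t: "A = vector [vector [cos t, - sin t], vector [sin t, cos t]]
    \<or> A = vector [vector [cos t, sin t], vector [sin t, - cos t]]"
    using orthogonal_matrix_planeE[OF A(1)] by blast
  have "g x = c + A *v (x - c)" for x
    using A(2)[of x c] assms(2) by simp
  with t have "g = rotation c t \<or> g = mirror c t"
    by (auto simp: fun_eq_iff rotation_def mirror_def)
  then show thesis
    by (rule that)
qed

section \<open>The groups generated by a rotation and a reflection\<close>

lemma BijGroup_UNIV:
  "carrier (BijGroup UNIV) = {f. bij f}" "\<one>\<^bsub>BijGroup UNIV\<^esub> = id"
  "bij f \<Longrightarrow> bij g \<Longrightarrow> f \<otimes>\<^bsub>BijGroup UNIV\<^esub> g = f \<circ> g"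
  by (auto simp: BijGroup_def Bij_def fun_eq_iff compose_def)

lemma inv_BijGroup_UNIV:
  assumes "bij f" "bij g" "g \<circ> f = id"
  shows "inv\<^bsub>BijGroup UNIV\<^esub> f = g"
  using assms by (intro group.inv_equality[OF group_BijGroup]) (auto simp: BijGroup_UNIV)

lemma subgroup_BijGroup_UNIV:
  assumes "id \<in> H" "\<And>f. f \<in> H \<Longrightarrow> bij f" "\<And>f g. f \<in> H \<Longrightarrow> g \<in> H \<Longrightarrow> f \<circ> g \<in> H"
    and "\<And>f. f \<in> H \<Longrightarrow> \<exists>g\<in>H. g \<circ> f = id"
  shows "subgroup H (BijGroup UNIV)"
proof
  show "inv\<^bsub>BijGroup UNIV\<^esub> f \<in> H" if "f \<in> H" for f
    using assms(2,4) that inv_BijGroup_UNIV by metis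
qed (use assms in \<open>auto simp: BijGroup_UNIV\<close>)

lemma generate_BijGroup_UNIV_comp:
  assumes "S \<subseteq> {f. bij f}" "f \<in> generate (BijGroup UNIV) S" "g \<in> generate (BijGroup UNIV) S"
  shows "f \<circ> g \<in> generate (BijGroup UNIV) S"
proof -
  have "generate (BijGroup UNIV) S \<subseteq> {f. bij f}"
    using group.generate_incl[OF group_BijGroup, of S UNIV] assms(1) by (simp add: BijGroup_UNIV)
  then have "bij f" "bij g"
    using assms by auto
  then show ?thesis
    using generate.eng[OF assms(2,3)] by (simp add: BijGroup_UNIV)
qed

lemma rotation_multiple_in_generate:
  assumes S: "S \<subseteq> {f. bij f}" "rotation c a \<in> S"
  shows "rotation c (of_int k * a) \<in> generate (BijGroup UNIV) S"
proof (induction k rule: int_induct[where k = 0])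
  case base
  have "rotation c (of_int 0 * a) = id"
    by simp
  then show ?case
    using generate.one[of "BijGroup UNIV" S] by (simp only: BijGroup_UNIV(2))
next
  case (step1 i)
  from generate_BijGroup_UNIV_comp[OF S(1) this(2) generate.incl[OF S(2)]] show ?case
    by (simp add: rotation_comp_rotation algebra_simps)
next
  case (step2 i)
  have "rotation c (- a) \<in> generate (BijGroup UNIV) S"
    using generate.inv[OF S(2), of "BijGroup UNIV"]
    by (simp add: inv_BijGroup_UNIV[OF bij_rotation bij_rotation rotation_comp_uminus(2)])
  from generate_BijGroup_UNIV_comp[OF S(1) step2(2) this] show ?case
    by (simp add: rotation_comp_rotation algebra_simps)
qed

text \<open>With all integers as indices, closure under products and inverses is just addition of
  multiples; passing to \<open>n\<close> indices is left to periodicity.\<close>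

lemma group_C_eq_range:
  assumes "n > 0"
  shows "group_C n c = range (\<lambda>k. rotation c (of_int k * (2 * pi / real n)))" (is "_ = ?R")
proof
  have "subgroup ?R (BijGroup UNIV)"
  proof (rule subgroup_BijGroup_UNIV)
    show "id \<in> ?R"
      by (rule range_eqI[of _ _ 0]) simp
    show "bij f" if "f \<in> ?R" for f
      using that bij_rotation by blast
    show "f \<circ> g \<in> ?R" if fg: "f \<in> ?R" "g \<in> ?R" for f g
    proof -
      obtain k l where "f = rotation c (of_int k * (2 * pi / real n))"
        "g = rotation c (of_int l * (2 * pi / real n))"
        using fg by blast
      then show ?thesis
        by (intro range_eqI[of _ _ "k + l"]) (simp only: rotation_comp_rotation of_int_add distrib_right)
    qed
    show "\<exists>g\<in>?R. g \<circ> f = id" if f: "f \<in> ?R" for f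
    proof -
      obtain k where k: "f = rotation c (of_int k * (2 * pi / real n))"
        using f by blast
      show ?thesis
        by (rule bexI[of _ "rotation c (of_int (- k) * (2 * pi / real n))"])
          (simp only: k rotation_comp_rotation of_int_minus mult_minus_left add.left_inverse rotation_0, blast)
    qed
  qed
  moreover have "rotation c (2 * pi / real n) \<in> ?R"
    by (rule range_eqI[of _ _ 1]) simp
  ultimately show "group_C n c \<subseteq> ?R"
    unfolding group_C_def by (simp add: group.generate_subgroup_incl[OF group_BijGroup])
  show "?R \<subseteq> group_C n c"
    unfolding group_C_def using rotation_multiple_in_generate bij_rotation by blast
qed

lemma group_Cv_eq_range:
  assumes "n > 0"
  shows "group_Cv n c (axis_line c t) = range (\<lambda>k. rotation c (of_int k * (2 * pi / real n)))
    \<union> range (\<lambda>k. mirror c (t + of_int k * (2 * pi / real n)))" (is "_ = ?R \<union> ?M")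
proof
  let ?a = "2 * pi / real n"
  let ?S = "{rotation c ?a, mirror c t}"
  have S: "?S \<subseteq> {f. bij f}"
    using bij_rotation bij_mirror by blast
  have "subgroup (?R \<union> ?M) (BijGroup UNIV)"
  proof (rule subgroup_BijGroup_UNIV)
    have "id \<in> ?R"
      by (rule range_eqI[of _ _ 0]) simp
    then show "id \<in> ?R \<union> ?M" ..
    show "bij f" if "f \<in> ?R \<union> ?M" for f
      using that bij_rotation bij_mirror by blast
    show "f \<circ> g \<in> ?R \<union> ?M" if fg: "f \<in> ?R \<union> ?M" "g \<in> ?R \<union> ?M" for f g
    proof -
      obtain k where k: "f = rotation c (of_int k * ?a) \<or> f = mirror c (t + of_int k * ?a)"
        using fg by blast
      obtain l where l: "g = rotation c (of_int l * ?a) \<or> g = mirror c (t + of_int l * ?a)"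
        using fg by blast
      \<comment> \<open>The angles of the four kinds of product: the index of the right factor is
        added after a rotation and subtracted after a mirror.\<close>
      have "of_int k * ?a + of_int l * ?a = of_int (k + l) * ?a"
        "of_int k * ?a + (t + of_int l * ?a) = t + of_int (k + l) * ?a"
        "t + of_int k * ?a - of_int l * ?a = t + of_int (k - l) * ?a"
        "t + of_int k * ?a - (t + of_int l * ?a) = of_int (k - l) * ?a"
        by (simp_all only: of_int_add of_int_diff distrib_right left_diff_distrib)
      then have "f \<circ> g \<in> {rotation c (of_int (k + l) * ?a), mirror c (t + of_int (k + l) * ?a),
          mirror c (t + of_int (k - l) * ?a), rotation c (of_int (k - l) * ?a)}"
        using k l by (elim disjE) (simp_all only: rotation_comp_rotation rotation_comp_mirror
          mirror_comp_rotation mirror_comp_mirror insert_iff simp_thms)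
      then show ?thesis
        by blast
    qed
    show "\<exists>g\<in>?R \<union> ?M. g \<circ> f = id" if f: "f \<in> ?R \<union> ?M" for f
      using f
    proof
      assume "f \<in> ?R"
      then obtain k where k: "f = rotation c (of_int k * ?a)"
        by blast
      have "rotation c (of_int (- k) * ?a) \<circ> f = id"
        by (simp only: k rotation_comp_rotation of_int_minus mult_minus_left add.left_inverse rotation_0)
      then show ?thesis
        by blast
    next
      assume "f \<in> ?M"
      then show ?thesis
        using mirror_comp_self by blast
    qed
  qed
  moreover have "rotation c ?a \<in> ?R"
    by (rule range_eqI[of _ _ 1]) simp
  moreover have "mirror c t \<in> ?M"
    by (rule range_eqI[of _ _ 0]) simp
  ultimately show "group_Cv n c (axis_line c t) \<subseteq> ?R \<union> ?M"
    unfolding group_Cv_def reflection_axis_line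
    by (intro group.generate_subgroup_incl[OF group_BijGroup]) simp_all
  have R: "rotation c (of_int k * ?a) \<in> group_Cv n c (axis_line c t)" for k
    unfolding group_Cv_def reflection_axis_line using S by (intro rotation_multiple_in_generate) simp_all
  moreover have "mirror c (t + of_int k * ?a) \<in> group_Cv n c (axis_line c t)" for k
  proof -
    have "rotation c (of_int k * ?a) \<circ> mirror c t \<in> group_Cv n c (axis_line c t)"
      using generate_BijGroup_UNIV_comp[OF S _ generate.incl] R[of k]
      unfolding group_Cv_def reflection_axis_line by blast
    then show ?thesis
      by (simp only: rotation_comp_mirror add.commute)
  qed
  ultimately show "?R \<union> ?M \<subseteq> group_Cv n c (axis_line c t)"
    by blast
qed

text \<open>Indices are reduced modulo \<open>n\<close>, the quotient contributing whole turns.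
  Stated for any function of period \<open>2 * pi\<close> so that it serves rotations and mirrors
  alike.\<close>

lemma periodic_range_eq_image:
  fixes f :: "real \<Rightarrow> 'a"
  assumes n: "n > 0" and f: "\<And>a m. f (a + of_int m * (2 * pi)) = f a"
  shows "range (\<lambda>k. f (of_int k * (2 * pi / real n)))
    = (\<lambda>k. f (of_int k * (2 * pi / real n))) ` {0..<int n}"
proof -
  have "f (of_int k * (2 * pi / real n)) = f (of_int (k mod int n) * (2 * pi / real n))" for k
  proof -
    have "of_int k = real_of_int (k mod int n) + of_int (k div int n) * real n"
      by (metis mod_mult_div_eq mult.commute of_int_add of_int_mult of_int_of_nat_eq)
    then have "of_int k * (2 * pi / real n)
        = of_int (k mod int n) * (2 * pi / real n) + of_int (k div int n) * (2 * pi)"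
      using n by (simp add: field_simps)
    then show ?thesis
      by (simp only: f)
  qed
  then show ?thesis
    using n by (auto intro!: image_eqI[of _ _ "_ mod int n"])
qed

lemma cos_add_multiple_2pi: "cos (a + of_int m * (2 * pi)) = cos a"
  and sin_add_multiple_2pi: "sin (a + of_int m * (2 * pi)) = sin a"
  using cos_int_2pin[of m] sin_int_2pin[of m] by (simp_all add: cos_add sin_add mult.commute mult.left_commute)

lemma group_C_eq_image:
  assumes "n > 0"
  shows "group_C n c = (\<lambda>k. rotation c (of_int k * (2 * pi / real n))) ` {0..<int n}"
  unfolding group_C_eq_range[OF assms]
  by (rule periodic_range_eq_image[OF assms])
    (intro rotation_cong cos_add_multiple_2pi sin_add_multiple_2pi)

lemma group_Cv_eq_image:
  assumes "n > 0"
  shows "group_Cv n c (axis_line c t) = (\<lambda>k. rotation c (of_int k * (2 * pi / real n))) ` {0..<int n}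
    \<union> (\<lambda>k. mirror c (t + of_int k * (2 * pi / real n))) ` {0..<int n}"
proof -
  have "mirror c (t + (a + of_int m * (2 * pi))) = mirror c (t + a)" for a m
    unfolding add.assoc[symmetric]
    by (intro mirror_cong cos_add_multiple_2pi sin_add_multiple_2pi)
  then show ?thesis
    unfolding group_Cv_eq_range[OF assms] group_C_eq_range[OF assms, symmetric] group_C_eq_image[OF assms]
    by (subst periodic_range_eq_image[OF assms, of "\<lambda>a. mirror c (t + a)"]) simp_all
qed

lemma rotation_eq_rotation_iff: "rotation c s = rotation c t \<longleftrightarrow> cos (s - t) = 1"
proof
  assume "rotation c s = rotation c t"
  then show "cos (s - t) = 1"
    by (simp add: rotation_eq_iff cos_diff power2_eq_square[symmetric])
next
  assume c: "cos (s - t) = 1"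
  then have "sin (s - t) = 0"
    using sin_cos_squared_add[of "s - t"] by simp
  with c have "cos ((s - t) + t) = cos t" "sin ((s - t) + t) = sin t"
    unfolding cos_add sin_add by simp_all
  then show "rotation c s = rotation c t"
    by (intro rotation_cong) simp_all
qed

lemma mirror_eq_mirror_iff: "mirror c s = mirror c t \<longleftrightarrow> cos (s - t) = 1"
  using rotation_eq_rotation_iff by (simp add: mirror_eq_iff rotation_eq_iff)

text \<open>Equal elements have angles differing by whole turns, so their indices are congruent
  modulo \<open>n\<close>.\<close>

lemma inj_on_multiples:
  assumes "n > 0"
  shows "inj_on (\<lambda>k. rotation c (of_int k * (2 * pi / real n))) {0..<int n}"
    and "inj_on (\<lambda>k. mirror c (t + of_int k * (2 * pi / real n))) {0..<int n}"
proof -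
  have *: "k = l" if kl: "k \<in> {0..<int n}" "l \<in> {0..<int n}"
    and cos: "cos (of_int k * (2 * pi / real n) - of_int l * (2 * pi / real n)) = 1" for k l
  proof -
    obtain m :: int where "of_int k * (2 * pi / real n) - of_int l * (2 * pi / real n) = of_int m * 2 * pi"
      using cos cos_one_2pi_int by blast
    then have "(of_int k - of_int l) * (2 * pi) = (of_int m * real n) * (2 * pi)"
      using assms by (simp add: field_simps)
    then have "of_int (k - l) = (of_int (m * int n) :: real)"
      by simp
    then have "k - l = m * int n"
      by (simp only: of_int_eq_iff)
    then have "k mod int n = l mod int n"
      by (metis diff_add_cancel mod_mult_self3)
    then show ?thesis
      using kl by simp
  qed
  show "inj_on (\<lambda>k. rotation c (of_int k * (2 * pi / real n))) {0..<int n}"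
    by (rule inj_onI) (use * in \<open>simp add: rotation_eq_rotation_iff\<close>)
  show "inj_on (\<lambda>k. mirror c (t + of_int k * (2 * pi / real n))) {0..<int n}"
    by (rule inj_onI) (use * in \<open>simp add: mirror_eq_mirror_iff\<close>)
qed

lemma card_group_C:
  assumes "n > 0"
  shows "card (group_C n c) = n"
  by (simp only: group_C_eq_image[OF assms] card_image[OF inj_on_multiples(1)[OF assms]]) simp

lemma card_group_Cv:
  assumes "n > 0"
  shows "card (group_Cv n c (axis_line c t)) = 2 * n"
proof -
  let ?R = "(\<lambda>k. rotation c (of_int k * (2 * pi / real n))) ` {0..<int n}"
  let ?M = "(\<lambda>k. mirror c (t + of_int k * (2 * pi / real n))) ` {0..<int n}"
  have "?R \<inter> ?M = {}"
    by (auto simp: mirror_ne_rotation mirror_ne_rotation[symmetric])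
  then have "card (?R \<union> ?M) = card ?R + card ?M"
    by (intro card_Un_disjoint) simp_all
  also have "\<dots> = 2 * n"
    unfolding card_image[OF inj_on_multiples(1)[OF assms]] card_image[OF inj_on_multiples(2)[OF assms]]
    by simp
  finally show ?thesis
    unfolding group_Cv_eq_image[OF assms] .
qed

lemma group_C_2: "group_C 2 c = {id, rotation c pi}"
proof -
  have "{0..<int 2} = {0, 1}" by auto
  then show ?thesis by (simp add: group_C_eq_image)
qed

lemma group_Cv_1: "group_Cv 1 c (axis_line c t) = {id, mirror c t}"
proof -
  have "{0..<int 1} = {0}" by auto
  then show ?thesis by (auto simp: group_Cv_eq_image)
qed

lemma group_Cv_2:
  "group_Cv 2 c (axis_line c t) = {id, rotation c pi, mirror c t, mirror c (t + pi)}"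
proof -
  have "{0..<int 2} = {0, 1}" by auto
  then show ?thesis by (auto simp: group_Cv_eq_image)
qed

section \<open>Orbit counting\<close>

text \<open>The group moves points of the plane, while orbits consist of indices, so
  \<open>pos\<close> mediates between the two. Joints use their positions with the action by
  application; bars use their sets of end positions with the action by image.\<close>

locale orbit_action =
  fixes G :: "('c \<Rightarrow> 'c) set" and act :: "('c \<Rightarrow> 'c) \<Rightarrow> 'z \<Rightarrow> 'z" and pos :: "'x \<Rightarrow> 'z"
    and orb :: "'x \<Rightarrow> 'x set"
  assumes id_mem: "id \<in> G" and comp_mem: "g \<in> G \<Longrightarrow> h \<in> G \<Longrightarrow> g \<circ> h \<in> G"
    and left_inverse: "g \<in> G \<Longrightarrow> \<exists>h\<in>G. h \<circ> g = id"
    and act_id: "act id z = z" and act_comp: "act (g \<circ> h) z = act g (act h z)"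
    and pos_inj: "pos x = pos y \<Longrightarrow> x = y"
    and act_closed: "g \<in> G \<Longrightarrow> \<exists>y. act g (pos x) = pos y"
    and orb_eq: "orb x = {y. \<exists>g\<in>G. act g (pos x) = pos y}"
begin

lemma inverse:
  assumes "g \<in> G"
  obtains h where "h \<in> G" "h \<circ> g = id" "g \<circ> h = id"
proof -
  obtain h where h: "h \<in> G" "h \<circ> g = id"
    using left_inverse[OF assms] by blast
  obtain k where k: "k \<circ> h = id"
    using left_inverse[OF h(1)] by blast
  have "k = k \<circ> (h \<circ> g)"
    by (simp add: h)
  also have "\<dots> = (k \<circ> h) \<circ> g"
    by (simp add: comp_assoc)
  finally have "k = g"
    by (simp add: k)
  with h k that show thesis by blast
qed

lemma act_inverse: "h \<circ> g = id \<Longrightarrow> act h (act g z) = z"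
  by (simp add: act_comp[symmetric] act_id)

lemma mem_orb_self: "x \<in> orb x"
  using id_mem act_id by (auto simp: orb_eq)

lemma orb_sym:
  assumes "y \<in> orb x"
  shows "x \<in> orb y"
proof -
  obtain g where g: "g \<in> G" "act g (pos x) = pos y"
    using assms by (auto simp: orb_eq)
  obtain h where "h \<in> G" "h \<circ> g = id"
    using left_inverse g(1) by blast
  then show ?thesis
    using g(2) act_inverse by (auto simp: orb_eq) (metis)
qed

lemma orb_trans:
  assumes "y \<in> orb x" "z \<in> orb y"
  shows "z \<in> orb x"
proof -
  obtain g h where "g \<in> G" "act g (pos x) = pos y" "h \<in> G" "act h (pos y) = pos z"
    using assms by (auto simp: orb_eq)
  then have "h \<circ> g \<in> G" "act (h \<circ> g) (pos x) = pos z"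
    using comp_mem act_comp by auto
  then show ?thesis
    by (auto simp: orb_eq)
qed

lemma orb_eqI: "y \<in> orb x \<Longrightarrow> orb y = orb x"
  using orb_sym orb_trans by blast

lemma partition_on_orbits:
  assumes "\<And>x. x \<in> S \<Longrightarrow> orb x \<subseteq> S"
  shows "partition_on S (orb ` S)"
proof (rule partition_onI)
  show "\<Union> (orb ` S) = S"
    using assms mem_orb_self by blast
  show "disjnt A B" if "A \<in> orb ` S" "B \<in> orb ` S" "A \<noteq> B" for A B
    using that orb_eqI unfolding disjnt_iff by (metis imageE)
  show "{} \<notin> orb ` S"
    using mem_orb_self by blast
qed

definition stabilizer :: "'x \<Rightarrow> ('c \<Rightarrow> 'c) set" where
  "stabilizer x = {g \<in> G. act g (pos x) = pos x}"

text \<open>The fibres of \<open>g \<mapsto> act g (pos x)\<close> over the orbit partition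
  \<open>G\<close>, and each of them is a left translate of the stabilizer.\<close>

lemma card_orb_mult_stabilizer:
  assumes "finite G"
  shows "card (orb x) * card (stabilizer x) = card G"
proof -
  define F where "F y = {g \<in> G. act g (pos x) = pos y}" for y
  have "pos ` orb x \<subseteq> (\<lambda>g. act g (pos x)) ` G"
    by (auto simp: orb_eq) (metis image_eqI)
  then have fin: "finite (orb x)"
    using assms by (meson finite_imageD finite_imageI finite_subset inj_onI pos_inj)
  have card: "card (F y) = card (stabilizer x)" if "y \<in> orb x" for y
  proof -
    obtain g where g: "g \<in> G" "act g (pos x) = pos y"
      using \<open>y \<in> orb x\<close> by (auto simp: orb_eq)
    obtain h where h: "h \<in> G" "h \<circ> g = id" "g \<circ> h = id"
      using inverse g(1) by blast
    have "act h (pos y) = pos x"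
      using act_inverse[OF h(2), of "pos x"] g(2) by simp
    then have "bij_betw (\<lambda>k. g \<circ> k) (stabilizer x) (F y)"
      by (intro bij_betw_byWitness[where f' = "\<lambda>k. h \<circ> k"])
        (auto simp: stabilizer_def F_def comp_assoc[symmetric] h g act_comp comp_mem)
    then show ?thesis
      by (simp add: bij_betw_same_card)
  qed
  have "G = (\<Union>y\<in>orb x. F y)"
    using act_closed by (fastforce simp: F_def orb_eq)
  moreover have "card (\<Union>y\<in>orb x. F y) = (\<Sum>y\<in>orb x. card (F y))"
  proof (rule card_UN_disjoint[OF fin])
    show "\<forall>y\<in>orb x. finite (F y)"
      using assms by (simp add: F_def)
    show "\<forall>y\<in>orb x. \<forall>z\<in>orb x. y \<noteq> z \<longrightarrow> F y \<inter> F z = {}"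
      using pos_inj by (auto simp: F_def)
  qed
  ultimately show ?thesis
    by (simp add: card)
qed

lemma card_orb_dvd: "finite G \<Longrightarrow> card (orb x) dvd card G"
  by (metis card_orb_mult_stabilizer dvd_triv_left)

lemma card_orb_free:
  assumes "finite G" "\<And>g. g \<in> G \<Longrightarrow> act g (pos x) = pos x \<Longrightarrow> g = id"
  shows "card (orb x) = card G"
proof -
  have "stabilizer x = {id}"
    using assms(2) id_mem act_id by (auto simp: stabilizer_def)
  then show ?thesis
    using card_orb_mult_stabilizer[OF assms(1), of x] by simp
qed

lemma card_orb_ne_1:
  assumes "g \<in> G" "act g (pos x) \<noteq> pos x"
  shows "card (orb x) \<noteq> 1"
proof
  assume "card (orb x) = 1"
  then have "orb x = {x}"
    using mem_orb_self by (metis card_1_singletonE singletonD)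
  moreover obtain y where "act g (pos x) = pos y"
    using act_closed assms(1) by blast
  ultimately show False
    using assms by (auto simp: orb_eq)
qed

text \<open>An orbit size divides the prime order and differs from 1 because \<open>g\<close> moves
  every element of \<open>S\<close>.\<close>

lemma occur_in_sets_of_prime:
  assumes "prime (card G)" "\<And>x. x \<in> S \<Longrightarrow> orb x \<subseteq> S"
    and "g \<in> G" "\<And>x. x \<in> S \<Longrightarrow> act g (pos x) \<noteq> pos x"
  shows "occur_in_sets_of {card G} orb S"
proof -
  \<comment> \<open>Infinite sets have cardinality 0, which is not prime.\<close>
  have "finite G"
    using prime_gt_0_nat[OF assms(1)] by (rule card_ge_0_finite)
  then have "card (orb x) = card G" if "x \<in> S" for x
    using assms(1) card_orb_dvd card_orb_ne_1[OF assms(3) assms(4)[OF that]] by (meson prime_nat_iff)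
  then show ?thesis
    using assms(2) by (simp add: occur_in_sets_of_def partition_on_orbits)
qed

text \<open>If \<open>r\<close> commutes with \<open>G\<close>, the elements it moves form a union
  of orbits; this makes the complement of the unshifted bars a set on which orbits can be
  counted.\<close>

lemma orb_subset_moved:
  assumes r: "r \<in> G" "\<And>g. g \<in> G \<Longrightarrow> r \<circ> g = g \<circ> r" and x: "act r (pos x) \<noteq> pos x"
  shows "orb x \<subseteq> {y. act r (pos y) \<noteq> pos y}"
proof safe
  fix y assume "y \<in> orb x" and y: "act r (pos y) = pos y"
  then obtain g where g: "g \<in> G" "act g (pos x) = pos y"
    by (auto simp: orb_eq)
  obtain h where h: "h \<circ> g = id"
    using left_inverse[OF g(1)] by blast
  have "act g (act r (pos x)) = act g (pos x)"
    using y g r(2)[OF g(1)] by (metis act_comp)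
  then show False
    using act_inverse[OF h] x by metis
qed

end

lemma even_card_if_occur_in_even_sets:
  fixes orb :: "'x::finite \<Rightarrow> 'x set"
  assumes "occur_in_sets_of K orb UNIV" "\<And>k. k \<in> K \<Longrightarrow> even k"
  shows "even CARD('x)"
proof -
  have P: "partition_on UNIV (range orb)" and K: "\<And>x. card (orb x) \<in> K"
    using assms(1) by (auto simp: occur_in_sets_of_def)
  have "CARD('x) = sum card (range orb)"
    using card_Union_disjoint[of "range orb"] P by (simp add: partition_on_def)
  then show ?thesis
    using K assms(2) by (auto intro: dvd_sum)
qed

section \<open>The point group of an isostatic framework\<close>

lemma plane_isometry_id: "plane_isometry id"
  by (simp add: plane_isometry_def)

lemma plane_isometry_comp: "plane_isometry g \<Longrightarrow> plane_isometry h \<Longrightarrow> plane_isometry (g \<circ> h)"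
  by (simp add: plane_isometry_def bij_comp)

lemma rotation_affine:
  "\<exists>a. \<forall>x. rotation c t x = a + vector [vector [cos t, - sin t], vector [sin t, cos t]] *v x"
  by (rule exI[of _ "c - vector [vector [cos t, - sin t], vector [sin t, cos t]] *v c"])
    (simp add: rotation_def matrix_vector_mult_diff_distrib algebra_simps)

lemma mirror_affine:
  "\<exists>a. \<forall>x. mirror c t x = a + vector [vector [cos t, sin t], vector [sin t, - cos t]] *v x"
  by (rule exI[of _ "c - vector [vector [cos t, sin t], vector [sin t, - cos t]] *v c"])
    (simp add: mirror_def matrix_vector_mult_diff_distrib algebra_simps)

text \<open>The two products have parameters \<open>t + pi\<close> and \<open>t - pi\<close>, which
  differ by a whole turn. So the half-turn commutes with every mirror through its centre.\<close>

lemma half_turn_comp_mirror: "rotation c pi \<circ> mirror c t = mirror c t \<circ> rotation c pi"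
  unfolding rotation_comp_mirror mirror_comp_rotation
  by (intro mirror_cong) (simp_all add: cos_add sin_add cos_diff sin_diff)

section \<open>The point group as a group acting on joints and bars\<close>

context bar_framework
begin

abbreviation "PG \<equiv> point_group ends p"

lemma id_in_point_group: "id \<in> PG"
  by (auto simp: point_group_def plane_isometry_id)

lemma comp_in_point_group:
  assumes "g \<in> PG" "h \<in> PG"
  shows "g \<circ> h \<in> PG"
proof -
  have "\<exists>e'. (g \<circ> h) ` p ` ends e = p ` ends e'" for e
  proof -
    obtain e1 where "h ` p ` ends e = p ` ends e1"
      using assms(2) unfolding point_group_def by blast
    moreover obtain e2 where "g ` p ` ends e1 = p ` ends e2"
      using assms(1) unfolding point_group_def by blast
    ultimately have "(g \<circ> h) ` p ` ends e = p ` ends e2"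
      unfolding image_comp[symmetric] by simp
    then show ?thesis ..
  qed
  moreover have "plane_isometry (g \<circ> h)"
    using assms by (simp add: point_group_def plane_isometry_comp)
  moreover have "bij_betw (g \<circ> h) (range p) (range p)"
    using assms by (auto simp: point_group_def intro: bij_betw_trans)
  ultimately show ?thesis
    by (simp add: point_group_def)
qed

text \<open>The inverse sends bars to bars because the induced map on bars is onto, so each bar is
  the image of one.\<close>

lemma inverse_in_point_group:
  assumes "g \<in> PG"
  shows "\<exists>h\<in>PG. h \<circ> g = id"
proof -
  define h where "h = inv_into UNIV g"
  have "bij g"
    using assms by (simp add: point_group_def plane_isometry_def)
  then have h: "h \<circ> g = id" "g \<circ> h = id"
    by (simp_all add: h_def bij_is_inj bij_is_surj surj_iff[THEN iffD1])
  then have hg: "h (g x) = x" and gh: "g (h x) = x" for x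
    by (simp_all add: fun_eq_iff)
  have "bij h"
    using h o_bij by blast
  moreover have "dist (h x) (h y) = dist x y" for x y
  proof -
    have "dist (g (h x)) (g (h y)) = dist (h x) (h y)"
      using assms by (simp add: point_group_def plane_isometry_def)
    then show ?thesis
      by (simp add: gh)
  qed
  moreover have "h ` range p = range p"
  proof -
    have "g ` range p = range p"
      using assms by (simp add: point_group_def bij_betw_def)
    then have "h ` range p = h ` g ` range p"
      by simp
    then show ?thesis
      by (simp add: image_image hg)
  qed
  moreover have "\<exists>e'. h ` p ` ends e = p ` ends e'" for e
  proof -
    obtain \<beta> where \<beta>: "bij \<beta>" "\<And>e. g ` p ` ends e = p ` ends (\<beta> e)"
      using point_group_bar_permE[OF assms] by blast
    obtain e' where "e = \<beta> e'"
      using \<beta>(1) by (metis bij_pointE)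
    then have "h ` p ` ends e = h ` g ` p ` ends e'"
      by (simp add: \<beta>(2))
    also have "\<dots> = p ` ends e'"
      by (simp add: image_comp[of h g] h)
    finally show ?thesis ..
  qed
  ultimately have "h \<in> PG"
    by (auto simp: point_group_def plane_isometry_def bij_betw_def bij_def intro: inj_on_subset)
  then show ?thesis
    using h by blast
qed

lemma subgroup_point_group: "subgroup PG (BijGroup UNIV)"
  by (intro subgroup_BijGroup_UNIV id_in_point_group comp_in_point_group inverse_in_point_group)
    (auto simp: point_group_def plane_isometry_def)

sublocale joints: orbit_action PG "\<lambda>g. g" p "joint_orbit ends p"
proof
  show "\<exists>v. g (p u) = p v" if "g \<in> PG" for g u
    using point_group_joint_permE[OF that] by metis
qed (auto simp: id_in_point_group comp_in_point_group inverse_in_point_group joint_orbit_def)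

sublocale bars: orbit_action PG "\<lambda>g S. g ` S" "\<lambda>e. p ` ends e" "bar_orbit ends p"
proof
  show "\<exists>e'. g ` p ` ends e = p ` ends e'" if "g \<in> PG" for g e
    using that by (simp add: point_group_def)
qed (auto simp: id_in_point_group comp_in_point_group inverse_in_point_group bar_orbit_def)

text \<open>A nontrivial rotation fixes only its centre, so it cannot fix both ends and must swap
  them. Its square then fixes a point other than the centre and is the identity.\<close>

lemma rotation_fixes_bar:
  assumes "e \<in> unshifted_bars ends p (rotation c t)" "cos t \<noteq> 1" and uv: "ends e = {u, v}" "u \<noteq> v"
  shows "rotation c t (p u) = p v" "rotation c t (p v) = p u" "p u \<noteq> c" "cos (2 * t) = 1"
proof -
  let ?g = "rotation c t"
  have img: "{?g (p u), ?g (p v)} = {p u, p v}"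
    using assms(1) uv by (simp add: unshifted_bars_def)
  have "\<not> (?g (p u) = p u \<and> ?g (p v) = p v)"
    using assms(2) uv(2) p_eq_iff unfolding rotation_fixed_iff by metis
  then show g: "?g (p u) = p v" "?g (p v) = p u"
    using img by (auto simp: doubleton_eq_iff)
  then show u: "p u \<noteq> c"
    using uv(2) rotation_fixed_iff[of c t c] by auto
  have "(?g \<circ> ?g) (p u) = p u"
    by (simp add: g)
  then show "cos (2 * t) = 1"
    using u unfolding rotation_comp_rotation rotation_fixed_iff by simp
qed

end

section \<open>Classification of the point group\<close>

context isostatic_framework
begin

abbreviation "c0 \<equiv> centroid p"

lemma rotation_in_point_group:
  assumes g: "rotation c t \<in> PG" and t: "cos t \<noteq> 1"
  shows "c = c0" "joints_at p c = {}"
    "cos t = - 1 \<and> card (unshifted_bars ends p (rotation c t)) = 1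
      \<or> cos t = - 1 / 2 \<and> card (unshifted_bars ends p (rotation c t)) = 0"
proof -
  show "c = c0"
    using point_group_fixes_centroid[OF g] t by (simp add: rotation_fixed_iff)
  let ?A = "vector [vector [cos t, - sin t], vector [sin t, cos t]] :: real ^ 2 ^ 2"
  let ?N = "card (joints_at p c)" and ?B = "card (unshifted_bars ends p (rotation c t))"
  obtain a where a: "\<And>x. rotation c t x = a + ?A *v x"
    using rotation_affine by blast
  have "{u. rotation c t (p u) = p u} = joints_at p c"
    using t by (simp add: rotation_fixed_iff joints_at_def)
  moreover have "trace ?A = 2 * cos t" "det ?A = 1"
    by (simp_all add: trace_def sum_2 det_2 power2_eq_square[symmetric])
  ultimately have eq: "real ?N * (2 * cos t) = real ?B + 2 * cos t + 1"
    using point_group_character[OF g a] by simp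
  have "\<exists>u. joints_at p c \<subseteq> {u}"
    using p_eq_iff unfolding joints_at_def by blast
  then have "?N \<le> 1"
    by (metis card_mono finite.intros is_singletonI is_singleton_altdef)
  \<comment> \<open>\<open>?N\<close> is at most 1, and for \<open>?N = 1\<close> the cosines
    cancel, leaving \<open>?B + 1 = 0\<close>.\<close>
  then have N: "?N = 0"
    using eq by (cases ?N) auto
  then show "joints_at p c = {}"
    by simp
  have "?B = 0" if ne: "cos t \<noteq> - 1"
  proof -
    have "e \<notin> unshifted_bars ends p (rotation c t)" for e
    proof
      assume e: "e \<in> unshifted_bars ends p (rotation c t)"
      obtain u v where "ends e = {u, v}" "u \<noteq> v"
        by (rule bar_ends)
      then have "cos (2 * t) = 1"
        using rotation_fixes_bar[OF e t] by blast
      then have "(cos t)\<^sup>2 = 1"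
        by (simp add: cos_double_cos)
      then show False
        using t ne by (simp add: power2_eq_1_iff)
    qed
    then show ?thesis
      by (metis all_not_in_conv card.empty)
  qed
  \<comment> \<open>With no fixed joint, \<open>?B = - 1 - 2 * cos t\<close>: this is 1 for the
    half-turn, and \<open>?B = 0\<close> forces the cosine of a three-fold rotation.\<close>
  then show "cos t = - 1 \<and> ?B = 1 \<or> cos t = - 1 / 2 \<and> ?B = 0"
    using eq N by (cases "cos t = - 1") auto
qed

text \<open>The trace of a reflection is zero, so the number of joints on the mirror drops out of
  the identity; the determinant -1 leaves the count of one bar.\<close>

lemma reflection_in_point_group:
  assumes L: "is_line L" and g: "reflection L \<in> PG"
  shows "c0 \<in> L" "card (unshifted_bars ends p (reflection L)) = 1"
proof -
  show c: "c0 \<in> L"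
    using point_group_fixes_centroid[OF g] by (simp add: L reflection_fixed_iff)
  obtain t where t: "L = axis_line c0 t"
    using line_as_axis_lineE[OF L c] .
  let ?A = "vector [vector [cos t, sin t], vector [sin t, - cos t]] :: real ^ 2 ^ 2"
  obtain a where a: "\<And>x. mirror c0 t x = a + ?A *v x"
    using mirror_affine by blast
  have "trace ?A = 0" "det ?A = - ((sin t)\<^sup>2 + (cos t)\<^sup>2)"
    by (simp_all add: trace_def sum_2 det_2 power2_eq_square)
  then show "card (unshifted_bars ends p (reflection L)) = 1"
    using point_group_character[of "mirror c0 t" a ?A] g a by (simp add: t reflection_axis_line)
qed

lemma point_group_elementE:
  assumes "g \<in> PG"
  obtains t where "g = rotation c0 t \<or> g = mirror c0 t"
  using plane_isometry_fixing_pointE[of g c0] assms point_group_fixes_centroid[OF assms]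
  by (auto simp: point_group_def)

text \<open>Every mirror passes through the centroid, so all of them are captured by the angle
  parameter alone.\<close>

lemma mirror_lines_eq: "mirror_lines ends p = axis_line c0 ` {t. mirror c0 t \<in> PG}"
proof
  show "mirror_lines ends p \<subseteq> axis_line c0 ` {t. mirror c0 t \<in> PG}"
  proof
    fix L assume "L \<in> mirror_lines ends p"
    then have L: "is_line L" "reflection L \<in> PG"
      by (auto simp: mirror_lines_def)
    then obtain t where "L = axis_line c0 t"
      using line_as_axis_lineE[OF L(1)] reflection_in_point_group[OF L] by blast
    then show "L \<in> axis_line c0 ` {t. mirror c0 t \<in> PG}"
      using L(2) by (auto simp: reflection_axis_line)
  qed
qed (auto simp: mirror_lines_def is_line_axis_line reflection_axis_line)

lemma axis_line_eq_iff: "axis_line c s = axis_line c t \<longleftrightarrow> mirror c s = mirror c t"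
  by (metis is_line_axis_line reflection_axis_line reflection_eq_iff)

lemma rotation_cos_cases:
  assumes "rotation c0 t \<in> PG"
  shows "cos t = 1 \<or> cos t = - 1 \<or> cos t = - 1 / 2"
  using rotation_in_point_group(3)[OF assms] by blast

lemma rotation_eq_by_cos:
  "cos t = 1 \<Longrightarrow> rotation c t = id"
  "cos t = - 1 \<Longrightarrow> rotation c t = rotation c pi"
  "cos t = - 1 / 2 \<Longrightarrow> rotation c t = rotation c (2 * pi / 3) \<or> rotation c t = rotation c (- (2 * pi / 3))"
proof -
  have sc: "(sin t)\<^sup>2 = 1 - (cos t)\<^sup>2"
    by (simp add: sin_squared_eq)
  show "rotation c t = id" if "cos t = 1"
    unfolding rotation_0[of c, symmetric] by (rule rotation_cong) (use sc that in simp_all)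
  show "rotation c t = rotation c pi" if "cos t = - 1"
    by (rule rotation_cong) (use sc that in simp_all)
  assume c: "cos t = - 1 / 2"
  then have "(sin t)\<^sup>2 = (sin (2 * pi / 3))\<^sup>2"
    by (simp add: sc sin_120 cos_120 power_divide)
  then have "sin t = sin (2 * pi / 3) \<or> sin t = - sin (2 * pi / 3)"
    by (simp add: power2_eq_iff)
  then show "rotation c t = rotation c (2 * pi / 3) \<or> rotation c t = rotation c (- (2 * pi / 3))"
    unfolding rotation_eq_iff using c by (auto simp: cos_120)
qed

lemma rotation_uminus_in_point_group:
  assumes "rotation c t \<in> PG"
  shows "rotation c (- t) \<in> PG"
proof -
  obtain h where h: "h \<in> PG" "h \<circ> rotation c t = id"
    using inverse_in_point_group[OF assms] by blast
  have "h = h \<circ> (rotation c t \<circ> rotation c (- t))"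
    by (simp add: rotation_comp_uminus)
  also have "\<dots> = rotation c (- t)"
    by (simp add: comp_assoc[symmetric] h)
  finally show ?thesis
    using h by simp
qed

text \<open>A half-turn and a three-fold rotation would compose to a rotation of order six, with cosine
  \<open>1 / 2\<close>.\<close>
lemma rotation_subgroup_order:
  obtains n :: nat where "n \<in> {1, 2, 3}" "rotation c0 (2 * pi / real n) \<in> PG"
    "\<And>t. rotation c0 t \<in> PG \<Longrightarrow> rotation c0 t \<in> group_C n c0"
proof -
  have gen: "rotation c0 (of_int k * (2 * pi / real n)) \<in> group_C n c0" if "n > 0" for n k
    using group_C_eq_range[OF that] by blast
  have id: "id \<in> group_C n c0" if "n > 0" for n
    using gen[OF that, of 0] by simp
  consider (half) "rotation c0 pi \<in> PG" | (third) "rotation c0 (2 * pi / 3) \<in> PG"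
    | (trivial) "rotation c0 pi \<notin> PG" "rotation c0 (2 * pi / 3) \<notin> PG"
    by blast
  then show thesis
  proof cases
    case half
    have "rotation c0 t \<in> group_C 2 c0" if t: "rotation c0 t \<in> PG" for t
    proof -
      have "cos (pi + t) = 1 \<or> cos (pi + t) = - 1 \<or> cos (pi + t) = - 1 / 2"
        using rotation_cos_cases comp_in_point_group[OF half t] by (simp only: rotation_comp_rotation)
      then have "cos t = 1 \<or> cos t = - 1"
        using rotation_cos_cases[OF t] by (auto simp: cos_add)
      then show ?thesis
        using rotation_eq_by_cos(1,2)[of t c0] unfolding group_C_2 by blast
    qed
    with half show thesis
      by (intro that[of 2]) simp_all
  next
    case third
    have "rotation c0 t \<in> group_C 3 c0" if t: "rotation c0 t \<in> PG" for t
    proof -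
      have "cos t \<noteq> - 1"
      proof
        assume c: "cos t = - 1"
        then have "(sin t)\<^sup>2 = 0"
          by (simp add: sin_squared_eq)
        then have "cos (2 * pi / 3 + t) = 1 / 2"
          unfolding cos_add by (simp add: c cos_120)
        moreover have "rotation c0 (2 * pi / 3 + t) \<in> PG"
          using comp_in_point_group[OF third t] by (simp only: rotation_comp_rotation)
        ultimately show False
          using rotation_cos_cases by force
      qed
      then consider "rotation c0 t = id" | "rotation c0 t = rotation c0 (2 * pi / 3)"
        | "rotation c0 t = rotation c0 (- (2 * pi / 3))"
        using rotation_cos_cases[OF t] rotation_eq_by_cos by blast
      then show ?thesis
        using id[of 3] gen[of 3 1] gen[of 3 "- 1"] by cases simp_all
    qed
    with third show thesis
      by (intro that[of 3]) simp_all
  next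
    case trivial
    have "rotation c0 t \<in> group_C 1 c0" if t: "rotation c0 t \<in> PG" for t
    proof -
      have minus: "rotation c0 (- (2 * pi / 3)) \<notin> PG"
        using trivial rotation_uminus_in_point_group[of c0 "- (2 * pi / 3)"] by auto
      consider "rotation c0 t = id" | "rotation c0 t = rotation c0 pi"
        | "rotation c0 t = rotation c0 (2 * pi / 3)" | "rotation c0 t = rotation c0 (- (2 * pi / 3))"
        using rotation_cos_cases[OF t] rotation_eq_by_cos by blast
      then have "rotation c0 t = id"
        using t trivial minus by cases simp_all
      then show ?thesis
        using id[of 1] by simp
    qed
    \<comment> \<open>For \<open>n = 1\<close> the generator is a full turn, which has to be
      recognised as the identity.\<close>
    moreover have "rotation c0 (2 * pi / real 1) = rotation c0 0"
      by (rule rotation_cong) simp_all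
    ultimately show thesis
      using id_in_point_group by (intro that[of 1]) simp_all
  qed
qed

lemma point_group_element_cases:
  assumes "g \<in> PG"
  shows "g = id \<or> (\<exists>c. g = rotation c pi)
    \<or> (\<exists>c. g = rotation c (2 * pi / 3) \<or> g = rotation c (- (2 * pi / 3)))
    \<or> (\<exists>L. is_line L \<and> g = reflection L)"
proof -
  obtain t where "g = rotation c0 t \<or> g = mirror c0 t"
    using point_group_elementE[OF assms] .
  then show ?thesis
  proof
    assume g: "g = rotation c0 t"
    then have "cos t = 1 \<or> cos t = - 1 \<or> cos t = - 1 / 2"
      using assms rotation_cos_cases by blast
    then show ?thesis
      unfolding g using rotation_eq_by_cos[of t c0] by metis
  next
    assume "g = mirror c0 t"
    then have "is_line (axis_line c0 t) \<and> g = reflection (axis_line c0 t)"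
      by (simp add: is_line_axis_line reflection_axis_line)
    then show ?thesis
      by blast
  qed
qed

text \<open>The rotations fix \<open>n\<close>. If some mirror is present, any other mirror of the
  group differs from it by a rotation of the group, so one mirror and the generating rotation
  account for everything.\<close>

lemma point_group_classification:
  "(\<exists>c. PG = group_C 1 c \<or> PG = group_C 2 c \<or> PG = group_C 3 c)
   \<or> (\<exists>c L. is_line L \<and> c \<in> L \<and> (PG = group_Cv 1 c L \<or> PG = group_Cv 2 c L \<or> PG = group_Cv 3 c L))"
proof -
  obtain n :: nat where n: "n \<in> {1, 2, 3}" and gen: "rotation c0 (2 * pi / real n) \<in> PG"
    and rot: "\<And>t. rotation c0 t \<in> PG \<Longrightarrow> rotation c0 t \<in> group_C n c0"
    using rotation_subgroup_order by blast
  have "n > 0"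
    using n by auto
  show ?thesis
  proof (cases "\<exists>t. mirror c0 t \<in> PG")
    case False
    have "group_C n c0 \<subseteq> PG"
      unfolding group_C_def
      using gen by (intro group.generate_subgroup_incl[OF group_BijGroup _ subgroup_point_group]) simp
    moreover have "PG \<subseteq> group_C n c0"
      using False rot point_group_elementE by (metis subsetI)
    ultimately have "PG = group_C n c0" by blast
    with n show ?thesis by blast
  next
    case True
    then obtain t where t: "mirror c0 t \<in> PG" ..
    let ?L = "axis_line c0 t"
    have "group_Cv n c0 ?L \<subseteq> PG"
      unfolding group_Cv_def reflection_axis_line
      using gen t by (intro group.generate_subgroup_incl[OF group_BijGroup _ subgroup_point_group]) simp
    moreover have "PG \<subseteq> group_Cv n c0 ?L"
    proof
      fix g assume g: "g \<in> PG"
      obtain s where "g = rotation c0 s \<or> g = mirror c0 s"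
        using point_group_elementE[OF g] .
      then show "g \<in> group_Cv n c0 ?L"
      proof
        assume "g = rotation c0 s"
        then have "g \<in> group_C n c0"
          using g rot by blast
        then show ?thesis
          by (simp add: group_C_eq_range group_Cv_eq_range \<open>n > 0\<close>)
      next
        assume s: "g = mirror c0 s"
        then have "rotation c0 (s - t) \<in> group_C n c0"
          using comp_in_point_group[OF g t] rot by (simp only: mirror_comp_mirror)
        then obtain k where k: "rotation c0 (s - t) = rotation c0 (of_int k * (2 * pi / real n))"
          unfolding group_C_eq_range[OF \<open>n > 0\<close>] by blast
        have "g = rotation c0 (s - t) \<circ> mirror c0 t"
          by (simp add: s rotation_comp_mirror)
        also have "\<dots> = mirror c0 (t + of_int k * (2 * pi / real n))"
          unfolding k rotation_comp_mirror by (simp only: add.commute)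
        finally show ?thesis
          unfolding group_Cv_eq_range[OF \<open>n > 0\<close>] by blast
      qed
    qed
    ultimately have "PG = group_Cv n c0 ?L" by blast
    with n show ?thesis
      using is_line_axis_line center_in_axis_line by blast
  qed
qed

end

section \<open>Orbits of joints and bars in each group\<close>

lemma perpendicular_commute: "perpendicular S L \<longleftrightarrow> perpendicular L S"
  unfolding perpendicular_def using orthogonal_commute by blast

lemma perpendicular_subset: "perpendicular S L \<Longrightarrow> T \<subseteq> S \<Longrightarrow> perpendicular T L"
  by (auto simp: perpendicular_def)

lemma (in bar_framework) bar_segment_subset_line:
  assumes "is_line L" "p ` ends e \<subseteq> L"
  shows "bar_segment ends p e \<subseteq> L"
  using assms by (simp add: bar_segment_def is_line_def hull_minimal affine_imp_convex)

context isostatic_framework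
begin

lemma odd_card_bars: "odd CARD('b)"
  using card_bars by presburger

lemma rotation_moves_joint:
  assumes "rotation c t \<in> PG" "cos t \<noteq> 1"
  shows "rotation c t (p u) \<noteq> p u"
  using rotation_in_point_group(2)[OF assms] assms(2)
  by (auto simp: joints_at_def rotation_fixed_iff)

text \<open>Serves the two groups of order 2, generated by a half-turn or by a reflection, where
  everything commutes with the generator.\<close>

lemma occur_in_sets_of_unshifted_complement:
  assumes G: "prime (card PG)" and r: "r \<in> PG" "\<And>g. g \<in> PG \<Longrightarrow> r \<circ> g = g \<circ> r"
  shows "occur_in_sets_of {card PG} (bar_orbit ends p) (- unshifted_bars ends p r)"
proof -
  have S: "- unshifted_bars ends p r = {e. r ` p ` ends e \<noteq> p ` ends e}"
    by (auto simp: unshifted_bars_def)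
  show ?thesis
    unfolding S using bars.orb_subset_moved[OF r]
    by (intro bars.occur_in_sets_of_prime[OF G _ r(1)]) blast+
qed

lemma C2_case:
  assumes G: "PG = group_C 2 c"
  shows "card (unshifted_bars ends p (rotation c pi)) = 1" "card (joints_at p c) = 0"
    "occur_in_sets_of {2} (bar_orbit ends p) (- unshifted_bars ends p (rotation c pi))"
    "occur_in_sets_of {2} (joint_orbit ends p) UNIV" "even CARD('j)"
proof -
  have r: "rotation c pi \<in> PG"
    by (simp add: G group_C_2)
  then show "card (unshifted_bars ends p (rotation c pi)) = 1" "card (joints_at p c) = 0"
    using rotation_in_point_group[of c pi] by simp_all
  have card: "card PG = 2"
    unfolding G by (simp add: card_group_C)
  have prime: "prime (card PG)"
    unfolding card by simp
  have commute: "rotation c pi \<circ> g = g \<circ> rotation c pi" if "g \<in> PG" for g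
    using that by (auto simp: G group_C_2)
  show "occur_in_sets_of {2} (bar_orbit ends p) (- unshifted_bars ends p (rotation c pi))"
    using occur_in_sets_of_unshifted_complement[OF prime r commute] by (simp add: card)
  show joints: "occur_in_sets_of {2} (joint_orbit ends p) UNIV"
    using joints.occur_in_sets_of_prime[OF prime subset_UNIV r rotation_moves_joint[OF r]]
    by (simp add: card)
  show "even CARD('j)"
    by (rule even_card_if_occur_in_even_sets[OF joints]) simp
qed

lemma C3_case:
  assumes G: "PG = group_C 3 c"
  shows "card (joints_at p c) = 0"
    "occur_in_sets_of {3} (joint_orbit ends p) UNIV"
    "occur_in_sets_of {3} (bar_orbit ends p) UNIV"
proof -
  let ?r = "rotation c (2 * pi / 3)"
  have cos: "cos (2 * pi / 3) \<noteq> 1"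
    by (simp add: cos_120)
  have r: "?r \<in> PG"
    unfolding G group_C_def by (auto intro: generate.incl)
  then show "card (joints_at p c) = 0"
    using rotation_in_point_group[OF r cos] by simp
  \<comment> \<open>The cosine is \<open>- 1 / 2\<close>, which selects the alternative without a
    fixed bar.\<close>
  have "card (unshifted_bars ends p ?r) = 0"
    using rotation_in_point_group(3)[OF r cos] by (simp add: cos_120)
  then have moved: "?r ` p ` ends e \<noteq> p ` ends e" for e
    by (auto simp: unshifted_bars_def)
  have card: "card PG = 3"
    unfolding G by (simp add: card_group_C)
  have prime: "prime (card PG)"
    unfolding card by simp
  show "occur_in_sets_of {3} (joint_orbit ends p) UNIV"
    using joints.occur_in_sets_of_prime[OF prime subset_UNIV r rotation_moves_joint[OF r cos]]
    by (simp add: card)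
  show "occur_in_sets_of {3} (bar_orbit ends p) UNIV"
    using bars.occur_in_sets_of_prime[OF prime subset_UNIV r moved]
    by (simp add: card)
qed

lemma Cs_case:
  assumes L: "is_line L" "c \<in> L" and G: "PG = group_Cv 1 c L"
  shows "card (unshifted_bars ends p (reflection L)) = 1"
    "occur_in_sets_of {2} (bar_orbit ends p) (- unshifted_bars ends p (reflection L))"
proof -
  obtain t where t: "L = axis_line c t"
    using line_as_axis_lineE[OF L] .
  have PG: "PG = {id, reflection L}"
    unfolding G t reflection_axis_line by (rule group_Cv_1)
  then have \<sigma>: "reflection L \<in> PG"
    by simp
  then show "card (unshifted_bars ends p (reflection L)) = 1"
    using reflection_in_point_group[OF L(1)] by simp
  have card: "card PG = 2"
    unfolding G t by (simp add: card_group_Cv)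
  have prime: "prime (card PG)"
    unfolding card by simp
  have commute: "reflection L \<circ> g = g \<circ> reflection L" if "g \<in> PG" for g
    using that by (auto simp: PG)
  show "occur_in_sets_of {2} (bar_orbit ends p) (- unshifted_bars ends p (reflection L))"
    using occur_in_sets_of_unshifted_complement[OF prime \<sigma> commute] by (simp add: card)
qed

text \<open>A reflection determines its line, so counting mirror lines amounts to counting the
  \<open>n\<close> distinct mirrors of the group.\<close>

lemma mirror_lines_group_Cv:
  assumes n: "n > 0" and G: "PG = group_Cv n c0 (axis_line c0 t)"
  shows "mirror_lines ends p = (\<lambda>k. axis_line c0 (t + of_int k * (2 * pi / real n))) ` {0..<int n}"
    and "card (mirror_lines ends p) = n"
proof -
  let ?t = "\<lambda>k. t + of_int k * (2 * pi / real n)"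
  have "mirror c0 s \<in> PG \<longleftrightarrow> (\<exists>k\<in>{0..<int n}. mirror c0 s = mirror c0 (?t k))" for s
    unfolding G group_Cv_eq_image[OF n] using mirror_ne_rotation by (auto simp: image_iff)
  then show eq: "mirror_lines ends p = (\<lambda>k. axis_line c0 (?t k)) ` {0..<int n}"
    unfolding mirror_lines_eq axis_line_eq_iff[symmetric] by blast
  have "inj_on (\<lambda>k. axis_line c0 (?t k)) {0..<int n}"
    using inj_on_multiples(2)[OF n, of c0 t] unfolding inj_on_def axis_line_eq_iff .
  from card_image[OF this] show "card (mirror_lines ends p) = n"
    unfolding eq by simp
qed

lemma mirror_line_card_unshifted:
  "M \<in> mirror_lines ends p \<Longrightarrow> card (unshifted_bars ends p (reflection M)) = 1"
  by (simp add: mirror_lines_def reflection_in_point_group)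

lemma C3v_case:
  assumes L: "is_line L" "c \<in> L" and G: "PG = group_Cv 3 c L"
  shows "card (joints_at p c) = 0" "card (mirror_lines ends p) = 3"
proof -
  have cos: "cos (2 * pi / 3) \<noteq> 1"
    by (simp add: cos_120)
  have r: "rotation c (2 * pi / 3) \<in> PG"
    unfolding G group_Cv_def by (auto intro: generate.incl)
  then show "card (joints_at p c) = 0"
    using rotation_in_point_group[OF r cos] by simp
  obtain t where t: "L = axis_line c t"
    using line_as_axis_lineE[OF L] .
  \<comment> \<open>The three-fold rotation identifies \<open>c\<close> with the centroid, about
    which mirror lines are counted.\<close>
  show "card (mirror_lines ends p) = 3"
    using mirror_lines_group_Cv(2)[of 3 t] G rotation_in_point_group(1)[OF r cos] by (simp add: t)
qed

text \<open>The half-turn is central, so its unique fixed bar is fixed by the whole group and is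
  also the one bar fixed by each mirror. Every other bar then has trivial stabilizer and an orbit of
  size 4.\<close>

lemma C2v_case:
  assumes L: "is_line L" "c \<in> L" and G: "PG = group_Cv 2 c L"
  shows "card (joints_at p c) = 0" "card (unshifted_bars ends p (rotation c pi)) = 1"
    "card (mirror_lines ends p) = 2"
    "\<exists>e M1 M2. unshifted_bars ends p (rotation c pi) = {e} \<and> mirror_lines ends p = {M1, M2}
       \<and> bar_segment ends p e \<subseteq> M1 \<and> perpendicular (bar_segment ends p e) M2"
    "occur_in_sets_of {4} (bar_orbit ends p) (- unshifted_bars ends p (rotation c pi))"
    "occur_in_sets_of {2, 4} (joint_orbit ends p) UNIV" "even CARD('j)"
proof -
  obtain t where t: "L = axis_line c t"
    using line_as_axis_lineE[OF L] .
  let ?r = "rotation c pi" and ?\<sigma> = "mirror c t" and ?\<tau> = "mirror c (t + pi)"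
  have PG: "PG = {id, ?r, ?\<sigma>, ?\<tau>}"
    unfolding G t by (rule group_Cv_2)
  then have r: "?r \<in> PG" and \<sigma>: "?\<sigma> \<in> PG" and \<tau>: "?\<tau> \<in> PG"
    by auto
  have c: "c = c0"
    using rotation_in_point_group(1)[OF r] by simp
  show "card (joints_at p c) = 0" and b2: "card (unshifted_bars ends p ?r) = 1"
    using rotation_in_point_group[OF r] by simp_all
  have card: "card PG = 4"
    unfolding G t by (simp add: card_group_Cv)
  \<comment> \<open>\<open>card\<close> is 0 on infinite sets, so the value 4 already gives
    finiteness.\<close>
  then have fin: "finite PG"
    by (metis card.infinite zero_neq_numeral)
  have G': "PG = group_Cv 2 c0 (axis_line c0 t)"
    using G by (simp add: t c)
  show "card (mirror_lines ends p) = 2"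
    using mirror_lines_group_Cv(2)[OF _ G'] by simp
  have "{0..<int 2} = {0, 1}"
    by auto
  then have lines: "mirror_lines ends p = {axis_line c t, axis_line c (t + pi)}"
    using mirror_lines_group_Cv(1)[OF _ G'] by (simp add: c)
  have commute: "?r \<circ> g = g \<circ> ?r" if "g \<in> PG" for g
    using that half_turn_comp_mirror by (auto simp: PG)
  have r_\<sigma>: "?r \<circ> ?\<sigma> = ?\<tau>"
    by (simp add: rotation_comp_mirror add.commute)

  obtain e where e: "unshifted_bars ends p ?r = {e}"
    using b2 card_1_singletonE by blast
  then have "e \<in> unshifted_bars ends p ?r"
    by simp
  then have re: "?r ` p ` ends e = p ` ends e"
    by (simp only: unshifted_bars_def mem_Collect_eq)
  \<comment> \<open>As \<open>g\<close> commutes with the half-turn, it carries \<open>e\<close> to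
    a bar that the half-turn also fixes; by uniqueness this is \<open>e\<close>.\<close>
  have fixes_e: "g ` p ` ends e = p ` ends e" if g: "g \<in> PG" for g
  proof -
    obtain e' where e': "g ` p ` ends e = p ` ends e'"
      using bars.act_closed[OF g] by blast
    have "?r ` p ` ends e' = (?r \<circ> g) ` p ` ends e"
      by (simp only: image_comp[symmetric] e')
    also have "\<dots> = g ` ?r ` p ` ends e"
      unfolding commute[OF g] by (simp only: image_comp[symmetric])
    finally have "?r ` p ` ends e' = p ` ends e'"
      by (simp only: re e')
    then have "e' \<in> unshifted_bars ends p ?r"
      by (simp add: unshifted_bars_def)
    with e e' show ?thesis by simp
  qed
  obtain u v where uv: "ends e = {u, v}" "u \<noteq> v"
    by (rule bar_ends)
  have r_uv: "?r (p u) = p v" "?r (p v) = p u"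
    using rotation_fixes_bar[of e c pi u v] e uv by simp_all
  have \<tau>_apply: "?\<tau> x = ?r (?\<sigma> x)" for x
    unfolding r_\<sigma>[symmetric] by simp
  have \<sigma>_r: "?\<sigma> (?r x) = ?r (?\<sigma> x)" for x
    using fun_cong[OF commute[OF \<sigma>], of x] by simp
  have "?\<sigma> (p u) \<in> p ` ends e"
    using fixes_e[OF \<sigma>] uv by blast
  then have "?\<sigma> (p u) = p u \<or> ?\<sigma> (p u) = p v"
    using uv by simp
  \<comment> \<open>If the first mirror fixes both ends, the bar lies in it. If it swaps them, its
    product with the half-turn, which is the second mirror, fixes both ends and the bar lies in that
    one.\<close>
  then have "p ` ends e \<subseteq> axis_line c t \<or> p ` ends e \<subseteq> axis_line c (t + pi)"
  proof
    assume u: "?\<sigma> (p u) = p u"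
    then have "?\<sigma> (p v) = p v"
      using \<sigma>_r[of "p u"] r_uv by simp
    with u show ?thesis
      by (simp add: uv mirror_fixed_iff)
  next
    assume u: "?\<sigma> (p u) = p v"
    then have "?\<sigma> (p v) = p u"
      using \<sigma>_r[of "p u"] r_uv by simp
    with u have "?\<tau> (p u) = p u" "?\<tau> (p v) = p v"
      by (simp_all add: \<tau>_apply r_uv)
    then show ?thesis
      by (simp add: uv mirror_fixed_iff)
  qed
  then show "\<exists>e M1 M2. unshifted_bars ends p ?r = {e} \<and> mirror_lines ends p = {M1, M2}
      \<and> bar_segment ends p e \<subseteq> M1 \<and> perpendicular (bar_segment ends p e) M2"
  proof
    assume "p ` ends e \<subseteq> axis_line c t"
    then have "bar_segment ends p e \<subseteq> axis_line c t"
      by (simp add: bar_segment_subset_line is_line_axis_line)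
    moreover from this have "perpendicular (bar_segment ends p e) (axis_line c (t + pi))"
      using perpendicular_axis_lines perpendicular_subset by blast
    ultimately show ?thesis
      using e lines by blast
  next
    assume "p ` ends e \<subseteq> axis_line c (t + pi)"
    then have "bar_segment ends p e \<subseteq> axis_line c (t + pi)"
      by (simp add: bar_segment_subset_line is_line_axis_line)
    moreover from this have "perpendicular (bar_segment ends p e) (axis_line c t)"
      using perpendicular_axis_lines perpendicular_commute perpendicular_subset by blast
    moreover have "mirror_lines ends p = {axis_line c (t + pi), axis_line c t}"
      using lines by blast
    ultimately show ?thesis
      using e by blast
  qed

  \<comment> \<open>Each mirror fixes exactly one bar, and \<open>e\<close> is already one that it
    fixes.\<close>
  have only_e: "x = e" if "mirror c s \<in> PG" "mirror c s ` p ` ends x = p ` ends x" for s x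
  proof -
    have "card (unshifted_bars ends p (mirror c s)) = 1"
      using reflection_in_point_group(2)[OF is_line_axis_line, of c s] that(1)
      by (simp add: reflection_axis_line)
    then obtain y where "unshifted_bars ends p (mirror c s) = {y}"
      using card_1_singletonE by blast
    moreover have "x \<in> unshifted_bars ends p (mirror c s)" "e \<in> unshifted_bars ends p (mirror c s)"
      using that fixes_e by (simp_all add: unshifted_bars_def)
    ultimately show ?thesis by simp
  qed
  have card_bar_orbit: "card (bar_orbit ends p x) = 4" if "x \<noteq> e" for x
  proof -
    have "g = id" if g: "g \<in> PG" "g ` p ` ends x = p ` ends x" for g
    proof -
      have "x \<notin> unshifted_bars ends p ?r"
        using e \<open>x \<noteq> e\<close> by simp
      then have "g \<noteq> ?r"
        using g(2) unfolding unshifted_bars_def by blast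
      moreover have "g \<noteq> ?\<sigma>" "g \<noteq> ?\<tau>"
        using only_e g \<open>x \<noteq> e\<close> by blast+
      ultimately show ?thesis
        using g(1) by (simp add: PG)
    qed
    then show ?thesis
      using bars.card_orb_free[OF fin] card by metis
  qed
  have closed: "bar_orbit ends p x \<subseteq> - {e}" if "x \<in> - {e}" for x
  proof -
    have "- {e} = {y. ?r ` p ` ends y \<noteq> p ` ends y}"
      unfolding e[symmetric] by (auto simp: unshifted_bars_def)
    then show ?thesis
      using bars.orb_subset_moved[OF r commute, of x] that by blast
  qed
  show "occur_in_sets_of {4} (bar_orbit ends p) (- unshifted_bars ends p ?r)"
    unfolding e occur_in_sets_of_def using card_bar_orbit bars.partition_on_orbits[OF closed] by simp
  \<comment> \<open>The size divides the group order 4, and it is not 1 because the half-turn moves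
    every joint.\<close>
  have "card (joint_orbit ends p u) \<in> {2, 4}" for u
  proof -
    have ne1: "card (joint_orbit ends p u) \<noteq> 1"
      using joints.card_orb_ne_1[OF r] rotation_moves_joint[OF r] by simp
    have dvd: "card (joint_orbit ends p u) dvd 4"
      using joints.card_orb_dvd[OF fin, of u] card by simp
    then have "card (joint_orbit ends p u) \<le> 4"
      by (simp add: dvd_imp_le)
    then consider "card (joint_orbit ends p u) = 0" | "card (joint_orbit ends p u) = 1"
      | "card (joint_orbit ends p u) = 2" | "card (joint_orbit ends p u) = 3"
      | "card (joint_orbit ends p u) = 4"
      by linarith
    then show ?thesis
    proof cases
      case 1
      then show ?thesis
        using dvd by (simp only: dvd_0_left_iff)
    next
      case 4
      have "\<not> 3 dvd (4::nat)"
        by simp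
      then show ?thesis
        using dvd by (simp only: 4)
    qed (use ne1 in simp_all)
  qed
  then show joints: "occur_in_sets_of {2, 4} (joint_orbit ends p) UNIV"
    by (simp add: occur_in_sets_of_def joints.partition_on_orbits)
  show "even CARD('j)"
    by (rule even_card_if_occur_in_even_sets[OF joints]) auto
qed

end

theorem mainTheorem1:
  fixes ends :: "'b::finite \<Rightarrow> 'j::finite set"
    and p :: "'j \<Rightarrow> plane"
    and G :: "(plane \<Rightarrow> plane) set"
  assumes "framework ends p"
    and "isostatic ends p"
    and G: "G = point_group ends p"
  shows
    "(\<forall>g\<in>G. g = id
        \<or> (\<exists>c. g = rotation c pi)
        \<or> (\<exists>c. g = rotation c (2 * pi / 3) \<or> g = rotation c (- (2 * pi / 3)))
        \<or> (\<exists>L. is_line L \<and> g = reflection L))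
     \<and> ((\<exists>c. G = group_C 1 c \<or> G = group_C 2 c \<or> G = group_C 3 c)
        \<or> (\<exists>c L. is_line L \<and> c \<in> L
             \<and> (G = group_Cv 1 c L \<or> G = group_Cv 2 c L \<or> G = group_Cv 3 c L)))
     \<and> int CARD('b) = 2 * int CARD('j) - 3
     \<and> (\<forall>c. G = group_C 2 c \<longrightarrow>
          card (unshifted_bars ends p (rotation c pi)) = 1
          \<and> card (joints_at p c) = 0
          \<and> occur_in_sets_of {2} (bar_orbit ends p) (- unshifted_bars ends p (rotation c pi))
          \<and> occur_in_sets_of {2} (joint_orbit ends p) UNIV
          \<and> even CARD('j) \<and> odd CARD('b))
     \<and> (\<forall>c. G = group_C 3 c \<longrightarrow>
          card (joints_at p c) = 0
          \<and> occur_in_sets_of {3} (joint_orbit ends p) UNIV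
          \<and> occur_in_sets_of {3} (bar_orbit ends p) UNIV)
     \<and> (\<forall>c L. is_line L \<and> c \<in> L \<and> G = group_Cv 1 c L \<longrightarrow>
          card (unshifted_bars ends p (reflection L)) = 1
          \<and> occur_in_sets_of {2} (bar_orbit ends p) (- unshifted_bars ends p (reflection L)))
     \<and> (\<forall>c L. is_line L \<and> c \<in> L \<and> G = group_Cv 2 c L \<longrightarrow>
          card (joints_at p c) = 0
          \<and> card (unshifted_bars ends p (rotation c pi)) = 1
          \<and> card (mirror_lines ends p) = 2
          \<and> (\<forall>M \<in> mirror_lines ends p. card (unshifted_bars ends p (reflection M)) = 1)
          \<and> (\<exists>e M1 M2. unshifted_bars ends p (rotation c pi) = {e}
               \<and> mirror_lines ends p = {M1, M2}
               \<and> bar_segment ends p e \<subseteq> M1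
               \<and> perpendicular (bar_segment ends p e) M2)
          \<and> occur_in_sets_of {4} (bar_orbit ends p) (- unshifted_bars ends p (rotation c pi))
          \<and> occur_in_sets_of {2, 4} (joint_orbit ends p) UNIV
          \<and> odd CARD('b) \<and> even CARD('j))
     \<and> (\<forall>c L. is_line L \<and> c \<in> L \<and> G = group_Cv 3 c L \<longrightarrow>
          card (joints_at p c) = 0
          \<and> card (mirror_lines ends p) = 3
          \<and> (\<forall>M \<in> mirror_lines ends p. card (unshifted_bars ends p (reflection M)) = 1))"
proof -
  interpret isostatic_framework ends p
    using assms(1,2) by unfold_locales (auto simp: framework_def)
  have "int CARD('b) = 2 * int CARD('j) - 3"
    using card_bars by linarith
  then show ?thesis
    unfolding G using point_group_classification odd_card_bars
    by (intro conjI ballI allI impI; (elim conjE)?)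
      (assumption | erule point_group_element_cases mirror_line_card_unshifted C2_case C3_case
        | erule (2) Cs_case C2v_case C3v_case)+
qed

end
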